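(* Let $X=(X(t);t\ge0)$ be a real-valued c\`adl\`ag process, let $S=(S(t);t\ge 0)$ be a strictly increasing subordinator independent of $X$, let $E(t)=\inf\{u:S(u)>t\}$, and let $X^*(t)=X(E(t))$. Fix a possibly random time $\tau\in[0,\infty]$ independent of $S$, and let $\tau^*=S(\tau)$ (with the convention $S(\infty)=\infty$). Define the increasing processes $A$ and $A^*$ by $$A(v)=\nu([0,\tau];(-\infty,v])\qquad\text{and}\qquad A^*(v)=\nu^*([0,\tau^*];(-\infty,v]),\qquad v\in\mathbb{R}.$$ Then $$\left(A^*(v);v\in\mathbb{R}\right)\overset{d}{=}\left(S(A(v));v\in\mathbb{R}\right).$$
   Context: For an interval $I\subset\mathbb{R}_+$ and a Borel set $\Gamma\subset\mathbb{R}$, the occupation measures are $\nu(I;\Gamma)=\operatorname{Leb}\{t\in I:X(t)\in \Gamma\}$ and $\nu^*(I;\Gamma)=\operatorname{Leb}\{t\in I:X^*(t)\in \Gamma\}$, where $\operatorname{Leb}$ is Lebesgue measure. A subordinator is an increasing L\'evy process (started at $0$). The symbol $\overset{d}{=}$ denotes equality in distribution of processes indexed by $v\in\mathbb{R}$.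
   Formalization: S is assumed independent of the pair (X, τ) jointly, not merely of X and of τ separately; with only the separate independences the claimed equality in distribution can fail. *)

theory Defs
  imports "HOL-Probability.Probability"
begin

text \<open>
  Processes indexed by \<open>[0,\<infinity>)\<close> are functions of type \<open>real \<Rightarrow> 'w \<Rightarrow> real\<close> of which only the
  values at times \<open>t \<ge> 0\<close> matter. Path properties are required almost surely.
\<close>

definition cadlag :: "(real \<Rightarrow> real) \<Rightarrow> bool" where
  "cadlag f \<longleftrightarrow>
     (\<forall>t\<ge>0. (f \<longlongrightarrow> f t) (at_right t)) \<and>
     (\<forall>t>0. \<exists>l. (f \<longlongrightarrow> l) (at_left t))"

definition cadlag_process :: "'w measure \<Rightarrow> (real \<Rightarrow> 'w \<Rightarrow> real) \<Rightarrow> bool" where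
  "cadlag_process M X \<longleftrightarrow>
     (\<forall>t\<ge>0. X t \<in> borel_measurable M) \<and>
     (AE \<omega> in M. cadlag (\<lambda>t. X t \<omega>))"

text \<open>
  Stochastic continuity is not listed: it follows from stationarity of the increments together
  with right-continuity at \<open>0\<close>.
\<close>

definition levy_process :: "'w measure \<Rightarrow> (real \<Rightarrow> 'w \<Rightarrow> real) \<Rightarrow> bool" where
  "levy_process M S \<longleftrightarrow>
     cadlag_process M S \<and>
     (AE \<omega> in M. S 0 \<omega> = 0) \<and>
     (\<forall>(n::nat) (t::nat \<Rightarrow> real). 0 \<le> t 0 \<longrightarrow> mono t \<longrightarrow>
        prob_space.indep_vars M (\<lambda>_. borel) (\<lambda>i \<omega>. S (t (Suc i)) \<omega> - S (t i) \<omega>) {..<n}) \<and>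
     (\<forall>s\<ge>0. \<forall>t\<ge>0. distr M borel (\<lambda>\<omega>. S (s + t) \<omega> - S s \<omega>) = distr M borel (S t))"

definition subordinator :: "'w measure \<Rightarrow> (real \<Rightarrow> 'w \<Rightarrow> real) \<Rightarrow> bool" where
  "subordinator M S \<longleftrightarrow>
     levy_process M S \<and> (AE \<omega> in M. mono_on {0..} (\<lambda>t. S t \<omega>))"

definition path_on :: "(real \<Rightarrow> 'w \<Rightarrow> real) \<Rightarrow> 'w \<Rightarrow> real \<Rightarrow> real" where
  "path_on X \<omega> = (\<lambda>t\<in>{0..}. X t \<omega>)"

abbreviation path_space :: "(real \<Rightarrow> real) measure" where
  "path_space \<equiv> PiM {0..} (\<lambda>_. borel)"

text \<open>
  Independence of two random elements, as in \<open>indep_var\<close>, which however requires both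
  value spaces to have the same type.
\<close>

definition indep_elements ::
  "'w measure \<Rightarrow> 'b measure \<Rightarrow> ('w \<Rightarrow> 'b) \<Rightarrow> 'c measure \<Rightarrow> ('w \<Rightarrow> 'c) \<Rightarrow> bool" where
  "indep_elements M N Y K Z \<longleftrightarrow>
     Y \<in> measurable M N \<and> Z \<in> measurable M K \<and>
     prob_space.indep_set M {Y -` B \<inter> space M | B. B \<in> sets N}
                            {Z -` C \<inter> space M | C. C \<in> sets K}"

text \<open>
  The infimum is over a nonempty set almost surely when \<open>S\<close> is a strictly increasing
  subordinator, since then \<open>S t\<close> tends to infinity almost surely.
\<close>

definition inverse_process :: "(real \<Rightarrow> 'w \<Rightarrow> real) \<Rightarrow> real \<Rightarrow> 'w \<Rightarrow> real" where
  "inverse_process S t \<omega> = Inf {u. 0 \<le> u \<and> t < S u \<omega>}"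

definition time_changed ::
  "(real \<Rightarrow> 'w \<Rightarrow> real) \<Rightarrow> (real \<Rightarrow> 'w \<Rightarrow> real) \<Rightarrow> real \<Rightarrow> 'w \<Rightarrow> real" where
  "time_changed X S t \<omega> = X (inverse_process S t \<omega>) \<omega>"

text \<open>The value of \<open>S\<close> at a time in \<open>[0,\<infinity>]\<close>, with \<open>S(\<infinity>) = \<infinity>\<close>.\<close>

definition eval_ext :: "(real \<Rightarrow> 'w \<Rightarrow> real) \<Rightarrow> ennreal \<Rightarrow> 'w \<Rightarrow> ennreal" where
  "eval_ext S a \<omega> = (if a = \<infinity> then \<infinity> else ennreal (S (enn2real a) \<omega>))"

definition occupation ::
  "(real \<Rightarrow> 'w \<Rightarrow> real) \<Rightarrow> real set \<Rightarrow> real set \<Rightarrow> 'w \<Rightarrow> ennreal" where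
  "occupation X I \<Gamma> \<omega> = emeasure lborel {t \<in> I. X t \<omega> \<in> \<Gamma>}"

text \<open>The interval \<open>[0,T]\<close> of finite times, which is \<open>[0,\<infinity>)\<close> if \<open>T = \<infinity>\<close>.\<close>

definition upto_time :: "ennreal \<Rightarrow> real set" where
  "upto_time T = {t. 0 \<le> t \<and> ennreal t \<le> T}"

text \<open>
  Equality in distribution of \<open>[0,\<infinity>]\<close>-valued processes indexed by the reals, as random
  elements of the product space (equivalently, equality of all finite-dimensional distributions).
  Measurability is part of the definition because \<open>distr\<close> is not meaningful without it.
  As path properties hold only almost surely, measurability is understood up to null sets,
  that is, with respect to the completion; for \<open>M\<close>-measurable processes this is the same
  as using \<open>M\<close> itself.
\<close>

definition eq_in_law ::
  "'w measure \<Rightarrow> (real \<Rightarrow> 'w \<Rightarrow> ennreal) \<Rightarrow> (real \<Rightarrow> 'w \<Rightarrow> ennreal) \<Rightarrow> bool" where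
  "eq_in_law M Y Z \<longleftrightarrow>
     (\<lambda>\<omega> v. Y v \<omega>) \<in> measurable (completion M) (PiM UNIV (\<lambda>_. borel)) \<and>
     (\<lambda>\<omega> v. Z v \<omega>) \<in> measurable (completion M) (PiM UNIV (\<lambda>_. borel)) \<and>
     distr (completion M) (PiM UNIV (\<lambda>_. borel)) (\<lambda>\<omega> v. Y v \<omega>) =
     distr (completion M) (PiM UNIV (\<lambda>_. borel)) (\<lambda>\<omega> v. Z v \<omega>)"

end

theory Submission
  imports Defs
begin

text \<open>
  Since \<open>E(t) \<le> u\<close> iff \<open>t \<le> S(u)\<close>, integrating \<open>H(E(t))\<close> over \<open>t > 0\<close> gives the Stieltjes integral
  of \<open>H\<close> with respect to \<open>dS\<close>. Hence \<open>A\<^sup>*(v)\<close> and \<open>S(A(v))\<close> are the integrals with respect to \<open>dS\<close>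
  of the indicators of \<open>{u \<le> \<tau>. X(u) \<le> v}\<close> and \<open>{u \<le> A(v)}\<close>, two families of sets that are independent
  of \<open>S\<close>, nested in \<open>v\<close> and of the same Lebesgue measures.
  If \<open>\<phi>\<close> is the Laplace exponent of \<open>S\<close> and \<open>H \<ge> 0\<close> is independent of \<open>S\<close>, then
  \<open>E exp(-\<integral>H dS) = E exp(-\<integral>\<phi>(H(u)) du)\<close>: for step functions on a grid this is
  independence of the increments, and right-continuity of \<open>X\<close> lets one pass to the limit pathwise
  when \<open>X\<close> is evaluated at right endpoints. For a combination \<open>H\<close> of indicators of nested sets,
  Abel summation shows that \<open>\<integral>\<phi>(H(u)) du\<close> depends only on the measures of the sets. So
  the joint Laplace transforms of the two processes agree.
\<close>

section \<open>Laplace transforms on the extended half-line\<close>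

text \<open>The grid points matter because \<open>clock_integral\<close> charges the jumps of S:
  pathwise, convergence for Lebesgue-almost every u would not do. At right endpoints
  right-continuity yields X(u) itself, not X(u-); the condition u \<le> \<tau> is left-continuous in
  u and is tested at left endpoints. Looking ahead inside a cell is harmless, since the integrand is
  independent of S. The condition X(u) \<le> v is not stable under limits and is reached by a second
  limit, through continuous ramps. A third, monotone limit removes a bounded time horizon, since
  \<tau> and the occupation times may be infinite. Right-continuity also makes A(v) a measurable
  function of (X, \<tau>), although evaluation (x, u) \<mapsto> x(u) is not jointly measurable for
  the product \<sigma>-algebra; this is how A(v) inherits independence from S. Since
  \<open>exp_neg\<close> sends infinity to 0 and finite values into (0,1], integer multiples in the
  Laplace transform become moments on the compact interval [0,1], which also record the mass at
  infinity. Path properties hold only almost surely, hence the completion.\<close>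

definition exp_neg :: "ennreal \<Rightarrow> real" where
  "exp_neg y = (if y = \<infinity> then 0 else exp (- enn2real y))"

lemma exp_neg_ennreal [simp]: "0 \<le> r \<Longrightarrow> exp_neg (ennreal r) = exp (- r)"
  by (simp add: exp_neg_def)

lemma exp_neg_top [simp]: "exp_neg \<infinity> = 0" "exp_neg top = 0"
  by (simp_all add: exp_neg_def)

lemma exp_neg_zero [simp]: "exp_neg 0 = 1"
  by (simp add: exp_neg_def)

lemma exp_neg_nonneg [simp]: "0 \<le> exp_neg y"
  by (simp add: exp_neg_def)

lemma exp_neg_le_1 [simp]: "exp_neg y \<le> 1"
  by (simp add: exp_neg_def)

lemma exp_neg_add: "exp_neg (x + y) = exp_neg x * exp_neg y"
  by (cases x; cases y) (auto simp flip: ennreal_plus simp: exp_add[symmetric] top_add)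

lemma exp_neg_sum: "exp_neg (\<Sum>i\<in>I. f i) = (\<Prod>i\<in>I. exp_neg (f i))"
  by (induction I rule: infinite_finite_induct) (simp_all add: exp_neg_add)

lemma exp_neg_of_nat_mult: "exp_neg (of_nat k * y) = exp_neg y ^ k"
  by (induction k) (simp_all add: exp_neg_add distrib_right)

lemma exp_neg_antimono: "x \<le> y \<Longrightarrow> exp_neg y \<le> exp_neg x"
  by (cases x; cases y) (auto simp: ennreal_le_iff top_unique)

lemma tendsto_exp_neg:
  assumes "(f \<longlongrightarrow> l) F"
  shows "((\<lambda>x. exp_neg (f x)) \<longlongrightarrow> exp_neg l) F"
proof (cases l)
  case (real r)
  have "eventually (\<lambda>x. f x < \<infinity>) F"
    using order_tendstoD(2)[OF assms, of \<infinity>] real by simp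
  moreover have "((\<lambda>x. exp (- enn2real (f x))) \<longlongrightarrow> exp (- r)) F"
    using assms real by (intro tendsto_intros) auto
  moreover have "\<forall>\<^sub>F x in F. exp (- enn2real (f x)) = exp_neg (f x)"
    using \<open>\<forall>\<^sub>F x in F. f x < \<infinity>\<close> by eventually_elim (simp add: exp_neg_def)
  ultimately have "((\<lambda>x. exp_neg (f x)) \<longlongrightarrow> exp (- r)) F"
    by (blast intro: Lim_transform_eventually)
  then show ?thesis
    using real by simp
next
  case top
  have "\<forall>\<^sub>F x in F. exp_neg (f x) < e" if "e > 0" for e
  proof -
    \<comment> \<open>Arguments above -ln e give values below e; the absolute value keeps the
      threshold nonnegative for \<open>ennreal\<close>, and the added 1 makes the inequality
      strict.\<close>
    have "\<forall>\<^sub>F x in F. ennreal (\<bar>ln e\<bar> + 1) < f x"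
      using order_tendstoD(1)[OF assms] top by simp
    then show ?thesis
    proof eventually_elim
      fix x assume "ennreal (\<bar>ln e\<bar> + 1) < f x"
      then have "exp_neg (f x) \<le> exp (- (\<bar>ln e\<bar> + 1))"
        using exp_neg_antimono[of "ennreal (\<bar>ln e\<bar> + 1)" "f x"] by (simp del: ennreal_plus)
      also have "\<dots> < exp (ln e)"
        by simp
      finally show "exp_neg (f x) < e"
        using that by simp
    qed
  qed
  then have "((\<lambda>x. exp_neg (f x)) \<longlongrightarrow> 0) F"
    by (intro order_tendstoI) (simp_all add: less_le_trans[OF _ exp_neg_nonneg])
  then show ?thesis
    using top by simp
qed

lemma borel_measurable_exp_neg [measurable]: "exp_neg \<in> borel_measurable borel"
  unfolding exp_neg_def by measurable

text \<open>\<open>exp_neg\<close> is injective with the Borel left inverse \<open>l\<close>, so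
  every event about a [0,\<infinity>]-valued variable is an event about its image in [0,1].\<close>

lemma exp_neg_vimage:
  assumes "A \<in> sets borel"
  obtains B where "B \<in> sets borel" "\<And>y. exp_neg y \<in> B \<longleftrightarrow> y \<in> A"
proof
  define l where "l x = (if x \<le> 0 then \<infinity> else ennreal (- ln x))" for x :: real
  have [measurable]: "l \<in> borel_measurable borel"
    unfolding l_def by measurable
  show "l -` A \<in> sets borel"
    using measurable_sets[of l borel borel A] assms by simp
  have "l (exp_neg y) = y" for y
    by (cases y) (auto simp: l_def)
  then show "exp_neg y \<in> l -` A \<longleftrightarrow> y \<in> A" for y
    by simp
qed

text \<open>For positive \<open>j\<close>, a continuous function equal to 1 on the nonpositive reals
  and to 0 from 1/j on. It leads from polynomials to half-line indicators in the moment problem, and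
  from continuous functions of X to the events X(u) \<le> v.\<close>

definition ramp :: "nat \<Rightarrow> real \<Rightarrow> real" where
  "ramp j y = max 0 (1 - real j * max 0 y)"

lemma ramp_bounds: "0 \<le> ramp j y" "ramp j y \<le> 1"
  by (simp_all add: ramp_def)

lemma continuous_on_ramp [continuous_intros]:
  "continuous_on A f \<Longrightarrow> continuous_on A (\<lambda>x. ramp j (f x))"
  unfolding ramp_def by (intro continuous_intros)

lemma isCont_ramp: "isCont (ramp j) x"
  using continuous_on_ramp[of UNIV "\<lambda>x. x" j] by (simp add: continuous_on_eq_continuous_at)

lemma borel_measurable_ramp [measurable]: "ramp j \<in> borel_measurable borel"
  unfolding ramp_def by measurable

lemma ramp_tendsto: "(\<lambda>j. ramp j y) \<longlonglongrightarrow> of_bool (y \<le> 0)"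
proof (cases "y \<le> 0")
  case False
  have "eventually (\<lambda>j. real j \<ge> 1 / y) sequentially"
    by (rule eventually_ge_at_top[THEN filterlim_real_sequentially[unfolded filterlim_iff, rule_format]])
  then have "eventually (\<lambda>j. ramp j y = 0) sequentially"
    by eventually_elim (use False in \<open>simp add: ramp_def field_simps\<close>)
  then show ?thesis
    using False by (simp add: tendsto_eventually)
qed (simp add: ramp_def)

section \<open>Moments on the unit interval determine joint laws\<close>

context prob_space
begin

text \<open>Weierstrass approximation on [0,1]; a weight bounded by 1 does not enlarge the error.
  The weights will hold the other coordinates of a random vector while one coordinate is
  treated.\<close>

lemma moments_imp_integral_continuous_eq:
  fixes W W' Y Y' :: "'a \<Rightarrow> real"
  assumes [measurable]: "W \<in> borel_measurable M" "W' \<in> borel_measurable M"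
      "Y \<in> borel_measurable M" "Y' \<in> borel_measurable M"
    and W: "\<And>x. W x \<in> {0..1}" "\<And>x. W' x \<in> {0..1}"
    and Y: "\<And>x. Y x \<in> {0..1}" "\<And>x. Y' x \<in> {0..1}"
    and eq: "\<And>k. (\<integral>x. W x * Y x ^ k \<partial>M) = (\<integral>x. W' x * Y' x ^ k \<partial>M)"
    and f: "continuous_on UNIV f"
  shows "(\<integral>x. W x * f (Y x) \<partial>M) = (\<integral>x. W' x * f (Y' x) \<partial>M)"
proof -
  have [measurable]: "f \<in> borel_measurable borel"
    using f by (rule borel_measurable_continuous_onI)
  obtain C where C: "\<And>y. y \<in> {0..1} \<Longrightarrow> \<bar>f y\<bar> \<le> C"
  proof -
    have "compact (f ` {0..1})"
      using f by (intro compact_continuous_image) (auto intro: continuous_on_subset)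
    then obtain B where "\<forall>y\<in>f ` {0..1}. norm y \<le> B"
      using compact_imp_bounded bounded_iff by metis
    then show thesis
      by (intro that[of B]) auto
  qed
  have int: "integrable M (\<lambda>x. V x * f (Z x))"
    if [measurable]: "V \<in> borel_measurable M" "Z \<in> borel_measurable M"
      and "\<And>x. V x \<in> {0..1}" "\<And>x. Z x \<in> {0..1}" for V Z :: "'a \<Rightarrow> real"
  proof (rule integrable_const_bound[where B = C])
    have "\<bar>V x\<bar> * \<bar>f (Z x)\<bar> \<le> 1 * C" for x
      using that(3)[of x] C[OF that(4)[of x]] by (intro mult_mono) auto
    then show "AE x in M. norm (V x * f (Z x)) \<le> C"
      by (simp add: abs_mult)
  qed measurable
  have "\<bar>(\<integral>x. W x * f (Y x) \<partial>M) - (\<integral>x. W' x * f (Y' x) \<partial>M)\<bar> \<le> e" if "e > 0" for e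
  proof -
    have "\<exists>p. real_polynomial_function p \<and> (\<forall>y\<in>{0..1}. \<bar>f y - p y\<bar> < e / 2)"
    proof (rule Stone_Weierstrass_real_polynomial_function
        [OF compact_Icc continuous_on_subset[OF f subset_UNIV], of "e / 2" 0 1])
      fix g :: "real \<Rightarrow> real"
      assume "real_polynomial_function g" "\<And>x. x \<in> {0..1} \<Longrightarrow> \<bar>f x - g x\<bar> < e / 2"
      then show ?thesis
        by (intro exI[of _ g]) simp
    qed (use that in simp)
    then obtain p where p: "real_polynomial_function p" "\<And>y. y \<in> {0..1} \<Longrightarrow> \<bar>f y - p y\<bar> < e / 2"
      by metis
    obtain a n where p_eq: "p = (\<lambda>y. \<Sum>i\<le>n. a i * y ^ i)"
      using p(1) by (auto simp: real_polynomial_function_iff_sum)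
    have intp: "integrable M (\<lambda>x. V x * Z x ^ k)"
      if [measurable]: "V \<in> borel_measurable M" "Z \<in> borel_measurable M"
        and "\<And>x. V x \<in> {0..1}" "\<And>x. Z x \<in> {0..1}" for V Z :: "'a \<Rightarrow> real" and k
    proof (rule integrable_const_bound[where B = 1])
      have "\<bar>V x\<bar> * \<bar>Z x ^ k\<bar> \<le> 1 * 1" for x
        using that(3)[of x] that(4)[of x]
        by (intro mult_mono) (auto simp: power_abs intro!: power_le_one)
      then show "AE x in M. norm (V x * Z x ^ k) \<le> 1"
        by (simp add: abs_mult)
    qed measurable
    have int_poly: "integrable M (\<lambda>x. V x * p (Z x))"
      and poly: "(\<integral>x. V x * p (Z x) \<partial>M) = (\<Sum>i\<le>n. a i * (\<integral>x. V x * Z x ^ i \<partial>M))"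
      if "V \<in> borel_measurable M" "Z \<in> borel_measurable M"
        and "\<And>x. V x \<in> {0..1}" "\<And>x. Z x \<in> {0..1}" for V Z :: "'a \<Rightarrow> real"
    proof -
      have *: "V x * p (Z x) = (\<Sum>i\<le>n. a i * (V x * Z x ^ i))" for x
        by (simp add: p_eq sum_distrib_left mult_ac)
      show "integrable M (\<lambda>x. V x * p (Z x))"
        unfolding * using intp[OF that] by (intro Bochner_Integration.integrable_sum integrable_mult_right) auto
      show "(\<integral>x. V x * p (Z x) \<partial>M) = (\<Sum>i\<le>n. a i * (\<integral>x. V x * Z x ^ i \<partial>M))"
        unfolding * using intp[OF that] by (subst Bochner_Integration.integral_sum) auto
    qed
    have close: "\<bar>(\<integral>x. V x * f (Z x) \<partial>M) - (\<integral>x. V x * p (Z x) \<partial>M)\<bar> \<le> e / 2"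
      if "V \<in> borel_measurable M" "Z \<in> borel_measurable M"
        and VZ: "\<And>x. V x \<in> {0..1}" "\<And>x. Z x \<in> {0..1}" for V Z :: "'a \<Rightarrow> real"
    proof -
      have "\<bar>V x * f (Z x) - V x * p (Z x)\<bar> \<le> e / 2" for x
      proof -
        have "\<bar>V x * (f (Z x) - p (Z x))\<bar> \<le> 1 * (e / 2)"
          unfolding abs_mult using VZ(1)[of x] p(2)[OF VZ(2)[of x]] by (intro mult_mono) auto
        then show ?thesis
          by (simp add: right_diff_distrib)
      qed
      then have "\<bar>\<integral>x. V x * f (Z x) - V x * p (Z x) \<partial>M\<bar> \<le> (\<integral>x. e / 2 \<partial>M)"
        using int[OF that] int_poly[OF that]
        by (intro order.trans[OF integral_abs_bound] integral_mono) auto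
      then show ?thesis
        using int[OF that] int_poly[OF that] by (simp add: prob_space)
    qed
    show ?thesis
    proof -
      have "(\<integral>x. W x * p (Y x) \<partial>M) = (\<integral>x. W' x * p (Y' x) \<partial>M)"
        by (simp only: poly[OF assms(1,3) W(1) Y(1)] poly[OF assms(2,4) W(2) Y(2)] eq)
      then show ?thesis
        using close[OF assms(1,3) W(1) Y(1)] close[OF assms(2,4) W(2) Y(2)] by linarith
    qed
  qed
  then have "\<bar>(\<integral>x. W x * f (Y x) \<partial>M) - (\<integral>x. W' x * f (Y' x) \<partial>M)\<bar> \<le> 0"
    by (rule field_le_epsilon) simp
  then show ?thesis
    by linarith
qed

text \<open>Uniqueness in the moment problem for the finite measures \<open>\<rho> W Y\<close>, the
  image under \<open>Y\<close> of the measure with density \<open>W\<close>: ramps turn equal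
  integrals of continuous functions into equal distribution functions.\<close>

lemma moments_imp_integral_indicator_eq:
  fixes W W' Y Y' :: "'a \<Rightarrow> real"
  assumes [measurable]: "W \<in> borel_measurable M" "W' \<in> borel_measurable M"
      "Y \<in> borel_measurable M" "Y' \<in> borel_measurable M" "A \<in> sets borel"
    and W: "\<And>x. W x \<in> {0..1}" "\<And>x. W' x \<in> {0..1}"
    and Y: "\<And>x. Y x \<in> {0..1}" "\<And>x. Y' x \<in> {0..1}"
    and eq: "\<And>k. (\<integral>x. W x * Y x ^ k \<partial>M) = (\<integral>x. W' x * Y' x ^ k \<partial>M)"
  shows "(\<integral>x. W x * indicator A (Y x) \<partial>M) = (\<integral>x. W' x * indicator A (Y' x) \<partial>M)"
proof -
  define \<rho> where "\<rho> V Z = distr (density M (\<lambda>x. ennreal (V x))) borel Z" for V Z :: "'a \<Rightarrow> real"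
  have int: "integrable M (\<lambda>x. V x * indicator B (Z x))"
    if [measurable]: "V \<in> borel_measurable M" "Z \<in> borel_measurable M" "B \<in> sets borel"
      and "\<And>x. V x \<in> {0..1}" for V Z :: "'a \<Rightarrow> real" and B
    using that(4) by (intro integrable_const_bound[where B = 1]) (auto simp: indicator_def)
  have emeas: "emeasure (\<rho> V Z) B = ennreal (\<integral>x. V x * indicator B (Z x) \<partial>M)"
    if [measurable]: "V \<in> borel_measurable M" "Z \<in> borel_measurable M" "B \<in> sets borel"
      and V: "\<And>x. V x \<in> {0..1}" for V Z :: "'a \<Rightarrow> real" and B
  proof -
    have "emeasure (\<rho> V Z) B = (\<integral>\<^sup>+x. ennreal (V x) * indicator (Z -` B \<inter> space M) x \<partial>M)"
      by (simp add: \<rho>_def emeasure_distr emeasure_density)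
    also have "\<dots> = (\<integral>\<^sup>+x. ennreal (V x * indicator B (Z x)) \<partial>M)"
      by (intro nn_integral_cong) (auto simp: indicator_def)
    also have "\<dots> = ennreal (\<integral>x. V x * indicator B (Z x) \<partial>M)"
      using V int[OF that] by (intro nn_integral_eq_integral) auto
    finally show ?thesis .
  qed
  have fin: "finite_borel_measure (\<rho> V Z)"
    if [measurable]: "V \<in> borel_measurable M" "Z \<in> borel_measurable M"
      and V: "\<And>x. V x \<in> {0..1}" for V Z :: "'a \<Rightarrow> real"
  proof (intro finite_borel_measure.intro finite_borel_measure_axioms.intro finite_measureI)
    show "emeasure (\<rho> V Z) (space (\<rho> V Z)) \<noteq> \<infinity>"
      using emeas[OF that(1,2) _ V, of UNIV] by (simp add: \<rho>_def)
  qed (simp add: \<rho>_def)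
  have "cdf (\<rho> W Y) c = cdf (\<rho> W' Y') c" for c
  proof -
    have lim: "(\<lambda>j. \<integral>x. V x * ramp j (Z x - c) \<partial>M) \<longlonglongrightarrow> (\<integral>x. V x * indicator {..c} (Z x) \<partial>M)"
      if [measurable]: "V \<in> borel_measurable M" "Z \<in> borel_measurable M"
        and V: "\<And>x. V x \<in> {0..1}" for V Z :: "'a \<Rightarrow> real"
    proof (rule integral_dominated_convergence[where w = "\<lambda>_. 1"])
      show "AE x in M. (\<lambda>j. V x * ramp j (Z x - c)) \<longlonglongrightarrow> V x * indicator {..c} (Z x)"
      proof (intro AE_I2 tendsto_mult tendsto_const)
        show "(\<lambda>j. ramp j (Z x - c)) \<longlonglongrightarrow> indicator {..c} (Z x)" for x
          using ramp_tendsto[of "Z x - c"] by (simp add: indicator_def)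
      qed
      show "AE x in M. norm (V x * ramp j (Z x - c)) \<le> 1" for j
        using V ramp_bounds by (auto simp: abs_mult intro!: mult_le_one)
    qed auto
    have "(\<integral>x. W x * ramp j (Y x - c) \<partial>M) = (\<integral>x. W' x * ramp j (Y' x - c) \<partial>M)" for j
      using moments_imp_integral_continuous_eq[OF assms(1-4) W Y eq, of "\<lambda>y. ramp j (y - c)"]
      by (simp add: continuous_intros)
    then have "(\<integral>x. W x * indicator {..c} (Y x) \<partial>M) = (\<integral>x. W' x * indicator {..c} (Y' x) \<partial>M)"
      using lim[of W Y] lim[of W' Y'] W by (auto intro: LIMSEQ_unique)
    then show ?thesis
      using emeas[of W Y "{..c}"] emeas[of W' Y' "{..c}"] W by (simp add: cdf_def measure_def)
  qed
  then have "\<rho> W Y = \<rho> W' Y'"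
    using fin W by (intro cdf_unique') auto
  then have "ennreal (\<integral>x. W x * indicator A (Y x) \<partial>M) = ennreal (\<integral>x. W' x * indicator A (Y' x) \<partial>M)"
    using emeas[of W Y A] emeas[of W' Y' A] W by simp
  then show ?thesis
    using W by (subst (asm) ennreal_inj) (auto intro!: integral_nonneg_AE)
qed

text \<open>
  The indicators are introduced one coordinate at a time, the remaining coordinates still carrying
  powers of \<open>exp_neg\<close>.
\<close>

lemma Laplace_imp_distr_PiM_eq:
  fixes Y Z :: "'i \<Rightarrow> 'a \<Rightarrow> ennreal"
  assumes meas [measurable]: "\<And>i. Y i \<in> borel_measurable M" "\<And>i. Z i \<in> borel_measurable M"
    and eq: "\<And>J k. finite J \<Longrightarrow> (\<integral>x. exp_neg (\<Sum>i\<in>J. of_nat (k i) * Y i x) \<partial>M) =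
                       (\<integral>x. exp_neg (\<Sum>i\<in>J. of_nat (k i) * Z i x) \<partial>M)"
  shows "distr M (PiM UNIV (\<lambda>_. borel)) (\<lambda>x i. Y i x) =
         distr M (PiM UNIV (\<lambda>_. borel)) (\<lambda>x i. Z i x)"
proof (rule measure_eqI_PiM_infinite)
  have [measurable]: "(\<lambda>x i. Y i x) \<in> measurable M (PiM UNIV (\<lambda>_. borel))"
    "(\<lambda>x i. Z i x) \<in> measurable M (PiM UNIV (\<lambda>_. borel))"
    by (auto intro!: measurable_PiM_single')
  show "finite_measure (distr M (PiM UNIV (\<lambda>_. borel)) (\<lambda>x i. Y i x))"
    by (intro finite_measure_distr) measurable
  fix A :: "'i \<Rightarrow> ennreal set" and J :: "'i set"
  assume J: "finite J" and A: "\<And>i. i \<in> J \<Longrightarrow> A i \<in> sets borel"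
  define ind where "ind F U x = (\<Prod>i\<in>F. indicator (A i) (U i x) :: real)"
    for F and U :: "'i \<Rightarrow> 'a \<Rightarrow> ennreal" and x
  define pw where "pw k G U x = (\<Prod>i\<in>G. exp_neg (U i x) ^ k i)"
    for k :: "'i \<Rightarrow> nat" and G and U :: "'i \<Rightarrow> 'a \<Rightarrow> ennreal" and x
  have ind01: "ind F U x \<in> {0..1}" for F U x
    by (auto simp: ind_def indicator_def intro!: prod_nonneg prod_le_1)
  have pw01: "pw k G U x \<in> {0..1}" for k G U x
    by (auto simp: pw_def intro!: prod_nonneg prod_le_1 power_le_one)
  \<comment> \<open>F interpolates between the hypothesis (F empty) and the finite-dimensional
    distributions (F = J, k = 0). The exponents stay arbitrary because each induction step consumes
    all moments of one coordinate.\<close>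
  have main: "(\<integral>x. ind F Y x * pw k (J - F) Y x \<partial>M) = (\<integral>x. ind F Z x * pw k (J - F) Z x \<partial>M)"
    if "finite F" "F \<subseteq> J" for F k
    using that
  proof (induction F arbitrary: k)
    case empty
    then show ?case
      using eq[OF J, of k] by (simp add: ind_def pw_def exp_neg_sum exp_neg_of_nat_mult)
  next
    case (insert i F)
    define W where "W U x = ind F U x * pw k (J - insert i F) U x" for U x
    have W01: "W U x \<in> {0..1}" for U x
      using ind01 pw01 by (auto simp: W_def intro!: mult_le_one)
    have [measurable]: "W U \<in> borel_measurable M" if [measurable]: "\<And>i. U i \<in> borel_measurable M" for U
    proof -
      have "(\<lambda>x. indicator (A i) (U i x) :: real) \<in> borel_measurable M" if "i \<in> F" for i
        using A[of i] insert.prems that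
        by (intro measurable_compose[OF \<open>U i \<in> borel_measurable M\<close> borel_measurable_indicator]) auto
      then show ?thesis
        unfolding W_def ind_def pw_def by measurable
    qed
    obtain B where B: "B \<in> sets borel" "\<And>y. exp_neg y \<in> B \<longleftrightarrow> y \<in> A i"
      using exp_neg_vimage[OF A[of i]] insert.prems by auto
    have Jeq: "J - F = insert i (J - insert i F)"
      using insert by auto
    have "(\<integral>x. W Y x * exp_neg (Y i x) ^ n \<partial>M) = (\<integral>x. W Z x * exp_neg (Z i x) ^ n \<partial>M)" for n
    proof -
      \<comment> \<open>Changing \<open>k\<close> at \<open>i\<close> alone produces every moment of
        coordinate \<open>i\<close> against the same weight \<open>W\<close>, which does not involve
        \<open>i\<close>.\<close>
      have *: "ind F U x * pw (k(i := n)) (J - F) U x = W U x * exp_neg (U i x) ^ n" for U x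
        unfolding Jeq W_def pw_def using J by (auto simp: mult_ac intro!: prod.cong)
      show ?thesis
        using insert.IH[of "k(i := n)"] insert.prems unfolding * by simp
    qed
    then have "(\<integral>x. W Y x * indicator B (exp_neg (Y i x)) \<partial>M) =
               (\<integral>x. W Z x * indicator B (exp_neg (Z i x)) \<partial>M)"
      using W01 B by (intro moments_imp_integral_indicator_eq) auto
    moreover have "W U x * indicator B (exp_neg (U i x)) =
        ind (insert i F) U x * pw k (J - insert i F) U x" for U x
      using B(2)[of "U i x"] insert.hyps by (simp add: W_def ind_def indicator_def)
    ultimately show ?case
      by simp
  qed
  have rect: "emeasure (distr M (PiM UNIV (\<lambda>_. borel)) (\<lambda>x i. U i x))
        (prod_emb UNIV (\<lambda>_. borel) J (Pi\<^sub>E J A)) = ennreal (\<integral>x. ind J U x \<partial>M)"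
    if [measurable]: "\<And>i. U i \<in> borel_measurable M" for U
  proof -
    have [measurable]: "(\<lambda>x i. U i x) \<in> measurable M (PiM UNIV (\<lambda>_. borel))"
      by (auto intro!: measurable_PiM_single')
    have meas_ind: "(\<lambda>x. ind J U x) \<in> borel_measurable M"
      unfolding ind_def using A
      by (intro borel_measurable_prod measurable_compose[OF that borel_measurable_indicator])
    have "emeasure (distr M (PiM UNIV (\<lambda>_. borel)) (\<lambda>x i. U i x))
        (prod_emb UNIV (\<lambda>_. borel) J (Pi\<^sub>E J A)) =
      emeasure M ((\<lambda>x i. U i x) -` prod_emb UNIV (\<lambda>_. borel) J (Pi\<^sub>E J A) \<inter> space M)"
      using J A by (intro emeasure_distr sets_PiM_I) auto
    also have "\<dots> = (\<integral>\<^sup>+x. indicator ((\<lambda>x i. U i x) -` prod_emb UNIV (\<lambda>_. borel) J (Pi\<^sub>E J A) \<inter> space M) x \<partial>M)"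
      using J A by (intro nn_integral_indicator[symmetric] measurable_sets[of _ _ "PiM UNIV (\<lambda>_. borel)"] sets_PiM_I) auto
    also have "\<dots> = (\<integral>\<^sup>+x. ennreal (ind J U x) \<partial>M)"
    proof (intro nn_integral_cong)
      fix x assume "x \<in> space M"
      show "indicator ((\<lambda>x i. U i x) -` prod_emb UNIV (\<lambda>_. borel) J (Pi\<^sub>E J A) \<inter> space M) x =
          ennreal (ind J U x)"
      proof (cases "\<forall>i\<in>J. U i x \<in> A i")
        case True
        then show ?thesis
          using \<open>x \<in> space M\<close> by (auto simp: ind_def prod_emb_def)
      next
        case False
        then have "ind J U x = 0"
          using J by (auto simp: ind_def intro!: prod_zero bexI)
        then show ?thesis
          using False by (auto simp: prod_emb_def indicator_def)
      qed
    qed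
    also have "\<dots> = ennreal (\<integral>x. ind J U x \<partial>M)"
      using ind01 meas_ind by (intro nn_integral_eq_integral integrable_const_bound[where B = 1]) auto
    finally show ?thesis .
  qed
  have "(\<integral>x. ind J Y x \<partial>M) = (\<integral>x. ind J Z x \<partial>M)"
    using main[OF J, of "\<lambda>_. 0"] by (simp add: pw_def)
  then show "emeasure (distr M (PiM UNIV (\<lambda>_. borel)) (\<lambda>x i. Y i x)) (prod_emb UNIV (\<lambda>_. borel) J (Pi\<^sub>E J A)) =
     emeasure (distr M (PiM UNIV (\<lambda>_. borel)) (\<lambda>x i. Z i x)) (prod_emb UNIV (\<lambda>_. borel) J (Pi\<^sub>E J A))"
    by (simp add: rect)
qed simp_all

end

section \<open>Abel summation along nested sets\<close>

text \<open>A monotone \<open>b\<close> selects an upper segment of J, so the left sum can only be a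
  tail sum of \<open>k\<close>. The coefficients are the increments of \<open>F\<close> between
  consecutive tail sums; they are nonnegative by monotonicity and the same for all
  \<open>b\<close>.\<close>

lemma mono_of_nested_sum:
  fixes F :: "real \<Rightarrow> real" and k :: "'i::linorder \<Rightarrow> real"
  assumes "finite J" and k: "\<And>v. 0 \<le> k v" and F: "mono_on {0..} F" "F 0 = 0"
  obtains c where "\<And>v. 0 \<le> c v"
    and "\<And>b. mono b \<Longrightarrow> F (\<Sum>v\<in>J. k v * of_bool (b v)) = (\<Sum>v\<in>J. c v * of_bool (b v))"
proof -
  have "\<exists>c. (\<forall>v. 0 \<le> c v) \<and>
      (\<forall>b. mono b \<longrightarrow> F (\<Sum>v\<in>J. k v * of_bool (b v)) = (\<Sum>v\<in>J. c v * of_bool (b v)))"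
    using \<open>finite J\<close>
  proof (induction J rule: finite_linorder_min_induct)
    case empty
    then show ?case
      using F by (intro exI[of _ "\<lambda>_. 0"]) simp
  next
    case (insert m J)
    then obtain c where c: "\<And>v. 0 \<le> c v"
      "\<And>b. mono b \<Longrightarrow> F (\<Sum>v\<in>J. k v * of_bool (b v)) = (\<Sum>v\<in>J. c v * of_bool (b v))"
      by blast
    define K where "K = (\<Sum>v\<in>J. k v)"
    have K: "0 \<le> K" "F K = (\<Sum>v\<in>J. c v)"
      using c(2)[of "\<lambda>_. True"] k by (auto simp: K_def mono_def intro: sum_nonneg)
    \<comment> \<open>If the new minimum \<open>m\<close> is selected, so is all of J; selecting it
      moves the argument of \<open>F\<close> from \<open>K\<close> to
      \<open>k m + K\<close>.\<close>
    define c' where "c' = c(m := F (k m + K) - F K)"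
    have m: "m \<notin> J"
      using insert by auto
    have "F K \<le> F (k m + K)"
      using F(1) K(1) k[of m] by (intro mono_onD[OF F(1)]) auto
    then have "0 \<le> c' v" for v
      using c by (simp add: c'_def)
    moreover have "F (\<Sum>v\<in>insert m J. k v * of_bool (b v)) = (\<Sum>v\<in>insert m J. c' v * of_bool (b v))"
      if "mono b" for b
    proof -
      have c'J: "(\<Sum>v\<in>J. c' v * of_bool (b v)) = (\<Sum>v\<in>J. c v * of_bool (b v))"
        using m by (intro sum.cong) (auto simp: c'_def)
      show ?thesis
      proof (cases "b m")
        case True
        then have "\<And>v. v \<in> J \<Longrightarrow> b v"
          using insert.hyps \<open>mono b\<close> by (metis less_imp_le monoD le_boolD)
        then have "(\<Sum>v\<in>J. x v * of_bool (b v)) = (\<Sum>v\<in>J. x v)" for x :: "'i \<Rightarrow> real"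
          by (intro sum.cong) auto
        then show ?thesis
          using True m insert.hyps K c'J by (simp add: c'_def K_def[symmetric])
      next
        case False
        then show ?thesis
          using m insert.hyps c(2)[OF \<open>mono b\<close>] c'J by simp
      qed
    qed
    ultimately show ?case
      by blast
  qed
  then show thesis
    using that by blast
qed

section \<open>Integrals along a time change\<close>

text \<open>Properties of almost every path of S; unboundedness keeps the infimum in
  \<open>clock\<close> off the empty set.\<close>

definition regular_path :: "(real \<Rightarrow> real) \<Rightarrow> bool" where
  "regular_path s \<longleftrightarrow> s 0 = 0 \<and> strict_mono_on {0..} s \<and>
     (\<forall>t\<ge>0. (s \<longlongrightarrow> s t) (at_right t)) \<and> (\<forall>c. \<exists>u\<ge>0. c < s u)"

text \<open>The process E as a function on the whole line. Nonpositive times go to 0, where the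
  concrete integrands below vanish, so integrating over all of \<open>lborel\<close> counts positive
  times only.\<close>

definition clock :: "(real \<Rightarrow> real) \<Rightarrow> real \<Rightarrow> real" where
  "clock s t = (if 0 < t then Inf {u. 0 \<le> u \<and> t < s u} else 0)"

text \<open>
  As \<open>clock s\<close> pushes Lebesgue measure forward to the Stieltjes measure of \<open>s\<close>, this
  is the integral of \<open>H\<close> with respect to \<open>ds\<close>.
\<close>

definition clock_integral :: "(real \<Rightarrow> real) \<Rightarrow> (real \<Rightarrow> real) \<Rightarrow> ennreal" where
  "clock_integral s H = (\<integral>\<^sup>+t. ennreal (H (clock s t)) \<partial>lborel)"

text \<open>With the identity as path, \<open>clock_integral\<close> is a Lebesgue integral over the
  half-line for integrands vanishing at 0. The limit lemmas thus serve both sides of the exponential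
  formula.\<close>

lemma regular_path_id: "regular_path (\<lambda>u. u)"
proof -
  have "\<exists>u\<ge>0. c < u" for c :: real
    by (intro exI[of _ "max 0 (c + 1)"]) auto
  then show ?thesis
    by (auto simp: regular_path_def strict_mono_on_def)
qed

section \<open>The generalized inverse of a path and convergence of integrals along it\<close>

context
  fixes s :: "real \<Rightarrow> real"
  assumes s: "regular_path s"
begin

lemma regular_path_zero: "s 0 = 0"
  using s by (simp add: regular_path_def)

lemma regular_path_mono: "0 \<le> u \<Longrightarrow> u \<le> v \<Longrightarrow> s u \<le> s v"
  using s by (cases "u = v") (auto simp: regular_path_def strict_mono_on_def intro!: less_imp_le)

lemma regular_path_nonneg: "0 \<le> u \<Longrightarrow> 0 \<le> s u"
  using regular_path_mono[of 0 u] by (simp add: regular_path_zero)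

text \<open>If t \<le> s(u), strict monotonicity puts every w > u into the set, so its infimum is at
  most u. If s(u) < t, right-continuity keeps s below t on an interval to the right of u, so the
  infimum exceeds u.\<close>

lemma Inf_level_le_iff:
  assumes "0 \<le> u"
  shows "Inf {u. 0 \<le> u \<and> t < s u} \<le> u \<longleftrightarrow> t \<le> s u"
proof -
  let ?A = "{u. 0 \<le> u \<and> t < s u}"
  have bdd: "bdd_below ?A"
    by (rule bdd_belowI[of _ 0]) simp
  have ne: "?A \<noteq> {}"
    using s by (auto simp: regular_path_def)
  show ?thesis
  proof
    assume "t \<le> s u"
    show "Inf ?A \<le> u"
    proof (rule dense_ge)
      fix w assume "u < w"
      then have "s u < s w"
        using s assms by (auto simp: regular_path_def strict_mono_on_def)
      then show "Inf ?A \<le> w"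
        using bdd \<open>t \<le> s u\<close> \<open>u < w\<close> assms by (intro cInf_lower) auto
    qed
  next
    assume le: "Inf ?A \<le> u"
    show "t \<le> s u"
    proof (rule ccontr)
      assume "\<not> t \<le> s u"
      then have "\<forall>\<^sub>F w in at_right u. s w < t"
        using s assms by (intro order_tendstoD) (auto simp: regular_path_def)
      then obtain b where b: "u < b" "\<And>w. u < w \<Longrightarrow> w < b \<Longrightarrow> s w < t"
        by (auto simp: eventually_at_right_field)
      have "b \<le> a" if "a \<in> ?A" for a
      proof (rule ccontr)
        assume "\<not> b \<le> a"
        then have "s a < t"
          using b(2)[of a] regular_path_mono[of a u] that \<open>\<not> t \<le> s u\<close> by (cases "a \<le> u") auto
        then show False
          using that by simp
      qed
      then have "b \<le> Inf ?A"
        using ne by (intro cInf_greatest)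
      then show False
        using le b by simp
    qed
  qed
qed

lemma clock_le_iff: "0 < t \<Longrightarrow> 0 \<le> u \<Longrightarrow> clock s t \<le> u \<longleftrightarrow> t \<le> s u"
  by (simp add: clock_def Inf_level_le_iff)

lemma clock_nonneg: "0 \<le> clock s t"
proof -
  have "{u. 0 \<le> u \<and> t < s u} \<noteq> {}"
    using s by (auto simp: regular_path_def)
  then have "0 \<le> Inf {u. 0 \<le> u \<and> t < s u}"
    by (intro cInf_greatest) auto
  then show ?thesis
    by (simp add: clock_def)
qed

lemma clock_pos_iff: "0 < clock s t \<longleftrightarrow> 0 < t"
  using clock_le_iff[of t 0] clock_nonneg[of t] by (auto simp: regular_path_zero clock_def)

lemma clock_mono: "mono (clock s)"
proof
  fix t t' :: real assume "t \<le> t'"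
  show "clock s t \<le> clock s t'"
  proof (cases "0 < t")
    case True
    then have "t' \<le> s (clock s t')"
      using clock_le_iff[of t' "clock s t'"] clock_nonneg \<open>t \<le> t'\<close> by simp
    then show ?thesis
      using True clock_le_iff[of t "clock s t'"] clock_nonneg \<open>t \<le> t'\<close> by simp
  next
    case False
    then show ?thesis
      using clock_nonneg[of t'] by (simp add: clock_def)
  qed
qed

lemma borel_measurable_clock [measurable]: "clock s \<in> borel_measurable borel"
  using clock_mono by (rule borel_measurable_mono)

text \<open>Left-open, right-closed intervals fit \<open>clock_le_iff\<close> exactly, so jumps of
  \<open>s\<close> need no endpoint correction.\<close>

lemma clock_vimage: "0 \<le> a \<Longrightarrow> a \<le> b \<Longrightarrow> clock s t \<in> {a<..b} \<longleftrightarrow> t \<in> {s a<..s b}"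
  using clock_le_iff[of t a] clock_le_iff[of t b] clock_pos_iff[of t]
    regular_path_nonneg[of a] regular_path_nonneg[of b]
  by (cases "0 < t") (auto simp: not_le)

lemma clock_integral_indicator:
  assumes "0 \<le> a" "a \<le> b"
  shows "(\<integral>\<^sup>+t. ennreal c * indicator {a<..b} (clock s t) \<partial>lborel) = ennreal c * ennreal (s b - s a)"
proof -
  have "indicator {a<..b} (clock s t) = (indicator {s a<..s b} t :: ennreal)" for t
    using clock_vimage[OF assms, of t] by (auto simp: indicator_def)
  then show ?thesis
    using regular_path_mono[OF assms] by (simp add: nn_integral_cmult_indicator)
qed

text \<open>The dominating function has the finite integral \<open>C * s T\<close>, whatever the
  jumps of \<open>s\<close>.\<close>

lemma clock_integral_dominated:
  assumes [measurable]: "\<And>m. H m \<in> borel_measurable borel"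
    and lim: "\<And>u. (\<lambda>m. H m u) \<longlonglongrightarrow> H' u"
    and bound: "\<And>m u. H m u \<le> C * indicator {0<..T} u" and "0 \<le> C" "0 \<le> T"
  shows "(\<lambda>m. clock_integral s (H m)) \<longlonglongrightarrow> clock_integral s H'"
  unfolding clock_integral_def
proof (rule nn_integral_dominated_convergence[where w = "\<lambda>t. ennreal C * indicator {0<..T} (clock s t)"])
  have [measurable]: "H' \<in> borel_measurable borel"
    using lim by (rule borel_measurable_LIMSEQ_metric[rotated]) measurable
  show "(\<lambda>t. ennreal (H' (clock s t))) \<in> borel_measurable lborel"
    "\<And>m. (\<lambda>t. ennreal (H m (clock s t))) \<in> borel_measurable lborel"
    "(\<lambda>t. ennreal C * indicator {0<..T} (clock s t)) \<in> borel_measurable lborel"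
    by measurable
  show "(\<integral>\<^sup>+t. ennreal C * indicator {0<..T} (clock s t) \<partial>lborel) < \<infinity>"
    using \<open>0 \<le> T\<close> by (subst clock_integral_indicator) (auto simp flip: ennreal_mult'' simp: regular_path_mono)
  show "AE t in lborel. ennreal (H m (clock s t)) \<le> ennreal C * indicator {0<..T} (clock s t)" for m
  proof (intro AE_I2)
    fix t
    have "ennreal (H m (clock s t)) \<le> ennreal (C * indicator {0<..T} (clock s t))"
      using bound by (rule ennreal_leI)
    then show "ennreal (H m (clock s t)) \<le> ennreal C * indicator {0<..T} (clock s t)"
      by (auto simp: indicator_def)
  qed
  show "AE t in lborel. (\<lambda>m. ennreal (H m (clock s t))) \<longlonglongrightarrow> ennreal (H' (clock s t))"
    using lim by (intro AE_I2 tendsto_ennrealI)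
qed

text \<open>Serves to remove the time horizon, when the limit may be infinite.\<close>

lemma clock_integral_monotone:
  assumes [measurable]: "\<And>m. H m \<in> borel_measurable borel"
    and lim: "\<And>u. (\<lambda>m. H m u) \<longlonglongrightarrow> H' u"
    and inc: "\<And>m m' u. m \<le> m' \<Longrightarrow> H m u \<le> H m' u"
  shows "(\<lambda>m. clock_integral s (H m)) \<longlonglongrightarrow> clock_integral s H'"
  unfolding clock_integral_def
proof (rule nn_integral_LIMSEQ)
  show "incseq (\<lambda>m t. ennreal (H m (clock s t)))"
    using inc by (auto simp: incseq_def le_fun_def intro: ennreal_leI)
  show "\<And>m. (\<lambda>t. ennreal (H m (clock s t))) \<in> borel_measurable lborel"
    by measurable
  show "(\<lambda>m. ennreal (H m (clock s t))) \<longlonglongrightarrow> ennreal (H' (clock s t))" for t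
    using lim by (rule tendsto_ennrealI)
qed

end

lemma clock_id: "clock (\<lambda>u. u) t = max 0 t"
proof (rule antisym)
  show "clock (\<lambda>u. u) t \<le> max 0 t"
    using clock_le_iff[OF regular_path_id, of t "max 0 t"] by (cases "0 < t") (auto simp: clock_def)
  show "max 0 t \<le> clock (\<lambda>u. u) t"
    using clock_le_iff[OF regular_path_id, of t "clock (\<lambda>u. u) t"] clock_nonneg[OF regular_path_id, of t]
    by (cases "0 < t") auto
qed

section \<open>Step functions on a grid\<close>

text \<open>For positive \<open>n\<close> and \<open>u\<close>, the index k with u in (k/n,
  (k+1)/n]; the ceiling gives the left-open cells that \<open>clock_vimage\<close> asks for.\<close>

definition cell :: "nat \<Rightarrow> real \<Rightarrow> nat" where
  "cell n u = nat (\<lceil>real n * u\<rceil> - 1)"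

lemma measurable_cell [measurable]: "cell n \<in> measurable borel (count_space UNIV)"
  unfolding cell_def by measurable

lemma cell_bounds:
  assumes "0 < n" "0 < u"
  shows "real (cell n u) / n < u" "u \<le> (real (cell n u) + 1) / n"
proof -
  have "0 < real n * u"
    using assms by simp
  then have "real (cell n u) = of_int \<lceil>real n * u\<rceil> - 1"
    unfolding cell_def by (subst of_nat_nat) (auto simp: le_ceiling_iff)
  then show "real (cell n u) / n < u" "u \<le> (real (cell n u) + 1) / n"
    using assms by (auto simp: field_simps) linarith+
qed

lemma cell_unique:
  assumes "0 < n" "real k / n < u" "u \<le> (real k + 1) / n"
  shows "cell n u = k"
proof -
  have "\<lceil>real n * u\<rceil> = int k + 1"
    using assms by (intro ceiling_unique) (auto simp: field_simps)
  then show ?thesis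
    by (simp add: cell_def)
qed

text \<open>An integer horizon \<open>T\<close> is the union of exactly \<open>n * T\<close> cells
  for every mesh, so truncation leaves no partial cell.\<close>

lemma cell_less_iff:
  assumes "0 < n" "0 < u"
  shows "cell n u < n * T \<longleftrightarrow> u \<le> real T"
proof
  assume "cell n u < n * T"
  then have "real (cell n u) + 1 \<le> real n * real T"
    by (metis Suc_eq_plus1 Suc_leI of_nat_1 of_nat_add of_nat_le_iff of_nat_mult)
  then have "(real (cell n u) + 1) / n \<le> T"
    using assms by (simp add: field_simps)
  then show "u \<le> real T"
    using cell_bounds[OF assms] by simp
next
  assume "u \<le> real T"
  then have "real (cell n u) / n < real T"
    using cell_bounds[OF assms] by simp
  then have "real (cell n u) < real (n * T)"
    using assms by (simp add: field_simps)
  then show "cell n u < n * T"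
    by (simp only: of_nat_less_iff)
qed

lemma cell_tendsto:
  assumes "0 < u"
  shows "(\<lambda>n. real (cell (Suc n) u) / real (Suc n)) \<longlonglongrightarrow> u"
    and "(\<lambda>n. (real (cell (Suc n) u) + 1) / real (Suc n)) \<longlonglongrightarrow> u"
proof -
  have inv: "(\<lambda>n. 1 / real (Suc n)) \<longlonglongrightarrow> 0"
    by (rule LIMSEQ_inverse_real_of_nat[unfolded inverse_eq_divide])
  then have lim: "(\<lambda>n. u - 1 / real (Suc n)) \<longlonglongrightarrow> u" "(\<lambda>n. u + 1 / real (Suc n)) \<longlonglongrightarrow> u"
    using tendsto_diff[OF tendsto_const inv, of u] tendsto_add[OF tendsto_const inv, of u] by simp_all
  have bounds: "u - 1 / real (Suc n) \<le> real (cell (Suc n) u) / real (Suc n)"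
    "real (cell (Suc n) u) / real (Suc n) \<le> u"
    "u \<le> (real (cell (Suc n) u) + 1) / real (Suc n)"
    "(real (cell (Suc n) u) + 1) / real (Suc n) \<le> u + 1 / real (Suc n)" for n
    using cell_bounds[OF zero_less_Suc assms, of n] by (simp_all add: add_divide_distrib)
  show "(\<lambda>n. real (cell (Suc n) u) / real (Suc n)) \<longlonglongrightarrow> u"
    by (rule tendsto_sandwich[OF always_eventually always_eventually lim(1) tendsto_const])
      (intro allI bounds)+
  show "(\<lambda>n. (real (cell (Suc n) u) + 1) / real (Suc n)) \<longlonglongrightarrow> u"
    by (rule tendsto_sandwich[OF always_eventually always_eventually tendsto_const lim(2)])
      (intro allI bounds)+
qed

definition step_fun :: "nat \<Rightarrow> nat \<Rightarrow> (nat \<Rightarrow> real) \<Rightarrow> real \<Rightarrow> real" where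
  "step_fun n N g u = (if 0 < u \<and> cell n u < N then g (cell n u) else 0)"

lemma borel_measurable_step_fun [measurable]: "step_fun n N g \<in> borel_measurable borel"
  unfolding step_fun_def by measurable

lemma step_fun_eq_sum:
  assumes "0 < n"
  shows "step_fun n N g u = (\<Sum>k<N. g k * indicator {real k / n<..(real k + 1) / n} u)"
proof (cases "0 < u")
  case True
  have "indicator {real k / n<..(real k + 1) / n} u = (of_bool (k = cell n u) :: real)" for k
  proof (cases "k = cell n u")
    case True
    then have "u \<in> {real k / n<..(real k + 1) / n}"
      using cell_bounds[OF assms \<open>0 < u\<close>] by simp
    then show ?thesis
      using True by simp
  next
    case False
    then have "u \<notin> {real k / n<..(real k + 1) / n}"
      using cell_unique[OF assms, of k u] by auto
    then show ?thesis
      using False by simp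
  qed
  then have "(\<Sum>k<N. g k * indicator {real k / n<..(real k + 1) / n} u) =
      (\<Sum>k<N. if k = cell n u then g k else 0)"
    by (intro sum.cong) auto
  then show ?thesis
    using True by (simp add: step_fun_def)
next
  case False
  then have "u \<notin> {real k / n<..(real k + 1) / n}" for k
    using order.trans[of u 0 "real k / n"] by auto
  then show ?thesis
    using False by (simp add: step_fun_def)
qed

lemma clock_integral_step_fun:
  assumes s: "regular_path s" and "0 < n" and g: "\<And>k. 0 \<le> g k"
  shows "clock_integral s (step_fun n N g) =
    ennreal (\<Sum>k<N. g k * (s ((real k + 1) / n) - s (real k / n)))"
proof -
  note [measurable] = borel_measurable_clock[OF s]
  have "ennreal (step_fun n N g u) = (\<Sum>k<N. ennreal (g k) * indicator {real k / n<..(real k + 1) / n} u)" for u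
    unfolding step_fun_eq_sum[OF \<open>0 < n\<close>] using g
    by (subst sum_ennreal[symmetric]) (auto simp: indicator_def intro!: sum.cong)
  then have "clock_integral s (step_fun n N g) =
      (\<Sum>k<N. \<integral>\<^sup>+t. ennreal (g k) * indicator {real k / n<..(real k + 1) / n} (clock s t) \<partial>lborel)"
    by (simp only: clock_integral_def) (intro nn_integral_sum, measurable)
  also have "\<dots> = (\<Sum>k<N. ennreal (g k * (s ((real k + 1) / n) - s (real k / n))))"
    using g by (intro sum.cong refl) (subst clock_integral_indicator[OF s], auto simp: divide_right_mono ennreal_mult')
  also have "\<dots> = ennreal (\<Sum>k<N. g k * (s ((real k + 1) / n) - s (real k / n)))"
    using g regular_path_mono[OF s]
    by (intro sum_ennreal mult_nonneg_nonneg) (auto simp: divide_right_mono)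
  finally show ?thesis .
qed

section \<open>The Laplace exponent of a strictly increasing subordinator\<close>

text \<open>Conditioning on \<open>Z\<close>: the joint law is a product measure, since it agrees
  with one on rectangles, and Fubini allows \<open>Z\<close> to be frozen while \<open>Y\<close> is
  averaged.\<close>

lemma nn_integral_indep_elements:
  assumes "prob_space M" and indep: "indep_elements M N Y K Z"
    and f [measurable]: "f \<in> borel_measurable (N \<Otimes>\<^sub>M K)"
  shows "(\<integral>\<^sup>+\<omega>. f (Y \<omega>, Z \<omega>) \<partial>M) = (\<integral>\<^sup>+\<omega>'. \<integral>\<^sup>+\<omega>. f (Y \<omega>, Z \<omega>') \<partial>M \<partial>M)"
proof -
  interpret prob_space M by fact
  have [measurable]: "Y \<in> measurable M N" "Z \<in> measurable M K"
    using indep by (auto simp: indep_elements_def)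
  interpret Y: prob_space "distr M N Y" by (rule prob_space_distr) measurable
  interpret Z: prob_space "distr M K Z" by (rule prob_space_distr) measurable
  interpret YZ: pair_prob_space "distr M N Y" "distr M K Z" ..
  have distr_eq: "distr M N Y \<Otimes>\<^sub>M distr M K Z = distr M (N \<Otimes>\<^sub>M K) (\<lambda>\<omega>. (Y \<omega>, Z \<omega>))"
  proof (rule pair_measure_eqI)
    fix B C assume "B \<in> sets (distr M N Y)" "C \<in> sets (distr M K Z)"
    then have [measurable]: "B \<in> sets N" "C \<in> sets K" by auto
    have "prob ((Y -` B \<inter> space M) \<inter> (Z -` C \<inter> space M)) = prob (Y -` B \<inter> space M) * prob (Z -` C \<inter> space M)"
      using indep by (intro indep_setD[of "{Y -` B \<inter> space M |B. B \<in> sets N}" "{Z -` C \<inter> space M |C. C \<in> sets K}"])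
        (auto simp: indep_elements_def)
    moreover have "(Y -` B \<inter> space M) \<inter> (Z -` C \<inter> space M) = (\<lambda>\<omega>. (Y \<omega>, Z \<omega>)) -` (B \<times> C) \<inter> space M"
      by auto
    ultimately show "emeasure (distr M N Y) B * emeasure (distr M K Z) C =
        emeasure (distr M (N \<Otimes>\<^sub>M K) (\<lambda>\<omega>. (Y \<omega>, Z \<omega>))) (B \<times> C)"
      by (simp add: emeasure_distr emeasure_eq_measure ennreal_mult)
  qed (auto intro: Y.sigma_finite_measure_axioms Z.sigma_finite_measure_axioms)
  have "(\<integral>\<^sup>+\<omega>. f (Y \<omega>, Z \<omega>) \<partial>M) = (\<integral>\<^sup>+p. f p \<partial>(distr M N Y \<Otimes>\<^sub>M distr M K Z))"
    by (simp add: distr_eq nn_integral_distr)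
  also have "\<dots> = (\<integral>\<^sup>+z. \<integral>\<^sup>+y. f (y, z) \<partial>distr M N Y \<partial>distr M K Z)"
    by (intro YZ.nn_integral_snd[symmetric]) measurable
  also have "\<dots> = (\<integral>\<^sup>+z. \<integral>\<^sup>+\<omega>. f (Y \<omega>, z) \<partial>M \<partial>distr M K Z)"
    by (intro nn_integral_cong nn_integral_distr) auto
  also have "\<dots> = (\<integral>\<^sup>+\<omega>'. \<integral>\<^sup>+\<omega>. f (Y \<omega>, Z \<omega>') \<partial>M \<partial>M)"
    by (intro nn_integral_distr) measurable
  finally show ?thesis .
qed

locale strict_subordinator = prob_space M for M :: "'w measure" +
  fixes S :: "real \<Rightarrow> 'w \<Rightarrow> real"
  assumes subordinator: "subordinator M S"
    and strict: "AE \<omega> in M. strict_mono_on {0..} (\<lambda>t. S t \<omega>)"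
begin

lemma measurable_S: "0 \<le> t \<Longrightarrow> S t \<in> borel_measurable M"
  using subordinator by (simp add: subordinator_def levy_process_def cadlag_process_def)

lemma AE_S_zero: "AE \<omega> in M. S 0 \<omega> = 0"
  using subordinator by (simp add: subordinator_def levy_process_def)

lemma AE_S_nonneg: "AE \<omega> in M. \<forall>t\<ge>0. 0 \<le> S t \<omega>"
  using AE_S_zero strict
proof eventually_elim
  case (elim \<omega>)
  then show ?case
    using strict_mono_on_leD[of "{0..}" "\<lambda>t. S t \<omega>" 0] by auto
qed

definition incr :: "nat \<Rightarrow> nat \<Rightarrow> 'w \<Rightarrow> real" where
  "incr n k \<omega> = S ((real k + 1) / real n) \<omega> - S (real k / real n) \<omega>"

lemma measurable_incr [measurable]: "incr n k \<in> borel_measurable M"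
  unfolding incr_def using measurable_S by (intro borel_measurable_diff) auto

lemma indep_incr: "indep_vars (\<lambda>_. borel) (incr n) {..<N}"
proof -
  have "mono (\<lambda>i. real i / real n)"
    by (auto simp: mono_def divide_right_mono)
  then have "indep_vars (\<lambda>_. borel) (\<lambda>i \<omega>. S (real (Suc i) / real n) \<omega> - S (real i / real n) \<omega>) {..<N}"
    using subordinator unfolding subordinator_def levy_process_def
    by (elim conjE allE[of _ N] allE[of _ "\<lambda>i. real i / real n"]) simp
  then show ?thesis
    by (simp add: incr_def[abs_def] add.commute)
qed

lemma distr_incr: "distr M borel (incr n k) = distr M borel (S (1 / real n))"
proof -
  have "distr M borel (\<lambda>\<omega>. S (s + t) \<omega> - S s \<omega>) = distr M borel (S t)" if "0 \<le> s" "0 \<le> t" for s t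
    using subordinator that by (simp add: subordinator_def levy_process_def)
  from this[of "real k / n" "1 / n"] show ?thesis
    by (simp add: incr_def[abs_def] add_divide_distrib)
qed

definition lap :: "real \<Rightarrow> real \<Rightarrow> real" where
  "lap t q = (\<integral>\<omega>. exp (- q * S t \<omega>) \<partial>M)"

lemma integrable_lap:
  assumes "0 \<le> t" "0 \<le> q"
  shows "integrable M (\<lambda>\<omega>. exp (- q * S t \<omega>))"
proof (rule integrable_const_bound[where B = 1])
  show "AE \<omega> in M. norm (exp (- q * S t \<omega>)) \<le> 1"
    using AE_S_nonneg by eventually_elim (use assms in simp)
qed (use measurable_S[OF assms(1)] in measurable)

lemma nn_integral_lap:
  "0 \<le> t \<Longrightarrow> 0 \<le> q \<Longrightarrow> (\<integral>\<^sup>+\<omega>. ennreal (exp (- q * S t \<omega>)) \<partial>M) = ennreal (lap t q)"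
  unfolding lap_def by (intro nn_integral_eq_integral integrable_lap) auto

lemma lap_pos:
  assumes "0 \<le> t" "0 \<le> q"
  shows "0 < lap t q"
proof -
  have "0 < (\<integral>\<omega>. exp (- q * S t \<omega>) \<partial>M)"
  proof (rule ccontr)
    assume "\<not> ?thesis"
    then have "(\<integral>\<omega>. exp (- q * S t \<omega>) \<partial>M) = 0"
      by (simp add: not_less antisym)
    then have "AE \<omega> in M. exp (- q * S t \<omega>) = 0"
      by (subst (asm) integral_nonneg_eq_0_iff_AE[OF integrable_lap[OF assms]]) auto
    then show False
      by (simp add: AE_False)
  qed
  then show ?thesis
    by (simp add: lap_def)
qed

lemma lap_mono:
  assumes "0 \<le> t" "0 \<le> q" "q \<le> \<mu>"
  shows "lap t \<mu> \<le> lap t q"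
  unfolding lap_def
proof (intro integral_mono_AE integrable_lap)
  show "AE \<omega> in M. exp (- \<mu> * S t \<omega>) \<le> exp (- q * S t \<omega>)"
    using AE_S_nonneg by eventually_elim (use assms in \<open>simp add: mult_right_mono\<close>)
qed (use assms in auto)

lemma lap_zero [simp]: "lap t 0 = 1"
  by (simp add: lap_def prob_space)

text \<open>Independence of the increments factorizes the expectation, and stationarity replaces
  each increment by S(1/n).\<close>

lemma nn_integral_exp_incr:
  assumes a: "\<And>k. 0 \<le> a k"
  shows "(\<integral>\<^sup>+\<omega>. ennreal (exp (- (\<Sum>k<N. a k * incr n k \<omega>))) \<partial>M) = ennreal (\<Prod>k<N. lap (1 / n) (a k))"
proof -
  have "(\<integral>\<^sup>+\<omega>. ennreal (exp (- (\<Sum>k<N. a k * incr n k \<omega>))) \<partial>M) =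
      (\<integral>\<^sup>+\<omega>. (\<Prod>k<N. ennreal (exp (- a k * incr n k \<omega>))) \<partial>M)"
    by (intro nn_integral_cong) (simp add: prod_ennreal exp_sum flip: sum_negf)
  also have "\<dots> = (\<Prod>k<N. \<integral>\<^sup>+\<omega>. ennreal (exp (- a k * incr n k \<omega>)) \<partial>M)"
    by (intro indep_vars_nn_integral indep_vars_compose2[OF indep_incr]) auto
  also have "\<dots> = (\<Prod>k<N. ennreal (lap (1 / n) (a k)))"
  proof (intro prod.cong refl)
    fix k
    have "(\<integral>\<^sup>+\<omega>. ennreal (exp (- a k * incr n k \<omega>)) \<partial>M) =
        (\<integral>\<^sup>+x. ennreal (exp (- a k * x)) \<partial>distr M borel (incr n k))"
      by (simp add: nn_integral_distr)
    also have "\<dots> = (\<integral>\<^sup>+\<omega>. ennreal (exp (- a k * S (1 / n) \<omega>)) \<partial>M)"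
      unfolding distr_incr using measurable_S[of "1 / n"] by (simp add: nn_integral_distr)
    also have "\<dots> = ennreal (lap (1 / n) (a k))"
      using a by (intro nn_integral_lap) auto
    finally show "(\<integral>\<^sup>+\<omega>. ennreal (exp (- a k * incr n k \<omega>)) \<partial>M) = ennreal (lap (1 / n) (a k))" .
  qed
  also have "\<dots> = ennreal (\<Prod>k<N. lap (1 / n) (a k))"
    using a by (intro prod_ennreal less_imp_le[OF lap_pos]) auto
  finally show ?thesis .
qed

text \<open>As S(0) = 0 almost surely, S(N/n) telescopes into N independent increments with the law
  of S(1/n).\<close>

lemma lap_power:
  assumes "0 \<le> q"
  shows "lap (real N / real n) q = lap (1 / real n) q ^ N"
proof -
  have "ennreal (lap (real N / real n) q) = (\<integral>\<^sup>+\<omega>. ennreal (exp (- q * S (real N / real n) \<omega>)) \<partial>M)"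
    using assms by (intro nn_integral_lap[symmetric]) auto
  also have "\<dots> = (\<integral>\<^sup>+\<omega>. ennreal (exp (- (\<Sum>k<N. q * incr n k \<omega>))) \<partial>M)"
  proof (rule nn_integral_cong_AE)
    have "(\<Sum>k<N. incr n k \<omega>) = S (real N / real n) \<omega> - S 0 \<omega>" for \<omega>
      using sum_lessThan_telescope[of "\<lambda>k. S (real k / real n) \<omega>" N]
      by (simp add: incr_def add.commute)
    then show "AE \<omega> in M. ennreal (exp (- q * S (real N / real n) \<omega>)) =
        ennreal (exp (- (\<Sum>k<N. q * incr n k \<omega>)))"
      using AE_S_zero by (auto simp flip: sum_distrib_left)
  qed
  also have "\<dots> = ennreal (lap (1 / real n) q ^ N)"
    using assms by (subst nn_integral_exp_incr) auto
  finally show ?thesis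
    using assms lap_pos[of "real N / real n" q] lap_pos[of "1 / real n" q]
    by (subst (asm) ennreal_inj) (auto intro: less_imp_le)
qed

text \<open>The Laplace exponent \<phi>; the logarithm is taken of a positive number by
  \<open>lap_pos\<close>.\<close>

definition exponent :: "real \<Rightarrow> real" where
  "exponent q = - ln (lap 1 q)"

text \<open>The n-th power of \<open>lap (1 / n) q\<close> is \<open>lap 1 q\<close>, so dividing
  the logarithm by n suffices and regularity in time does not enter.\<close>

lemma lap_eq_exp:
  assumes "0 < n" "0 \<le> q"
  shows "lap (1 / real n) q = exp (- (exponent q / n))"
proof -
  have "ln (lap 1 q) = real n * ln (lap (1 / real n) q)"
    using lap_power[of q n n] lap_pos[of "1 / real n" q] assms by (simp add: ln_realpow)
  then have "- (exponent q / n) = ln (lap (1 / real n) q)"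
    using assms by (simp add: exponent_def)
  then show ?thesis
    using lap_pos[of "1 / real n" q] assms by (simp only:) simp
qed

lemma exponent_zero: "exponent 0 = 0"
  by (simp add: exponent_def)

lemma exponent_mono: "mono_on {0..} exponent"
  by (auto simp: mono_on_def exponent_def lap_pos lap_mono intro!: ln_mono)

lemma exponent_nonneg: "0 \<le> q \<Longrightarrow> 0 \<le> exponent q"
  using mono_onD[OF exponent_mono, of 0 q] by (simp add: exponent_zero)

lemma exponent_tendsto:
  assumes "\<And>m. 0 \<le> f m" "f \<longlonglongrightarrow> l"
  shows "(\<lambda>m. exponent (f m)) \<longlonglongrightarrow> exponent l"
proof -
  have "0 \<le> l"
    using assms by (intro LIMSEQ_le_const) auto
  have [measurable]: "S 1 \<in> borel_measurable M"
    by (rule measurable_S) simp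
  have "(\<lambda>m. lap 1 (f m)) \<longlonglongrightarrow> lap 1 l"
    unfolding lap_def
  proof (rule integral_dominated_convergence[where w = "\<lambda>_. 1"])
    show "AE \<omega> in M. (\<lambda>m. exp (- f m * S 1 \<omega>)) \<longlonglongrightarrow> exp (- l * S 1 \<omega>)"
      using assms by (intro AE_I2 tendsto_intros)
    show "AE \<omega> in M. norm (exp (- f m * S 1 \<omega>)) \<le> 1" for m
      using AE_S_nonneg by eventually_elim (use assms in simp)
  qed auto
  then show ?thesis
    unfolding exponent_def using lap_pos[of 1 l] \<open>0 \<le> l\<close> by (intro tendsto_intros) auto
qed

lemma borel_measurable_exponent:
  assumes [measurable]: "f \<in> borel_measurable N" and "\<And>x. 0 \<le> f x"
  shows "(\<lambda>x. exponent (f x)) \<in> borel_measurable N"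
proof -
  have "mono (\<lambda>x. exponent (max 0 x))"
    by (intro monoI mono_onD[OF exponent_mono]) auto
  then have [measurable]: "(\<lambda>x. exponent (max 0 x)) \<in> borel_measurable borel"
    by (rule borel_measurable_mono)
  have "(\<lambda>x. exponent (max 0 (f x))) \<in> borel_measurable N"
    by measurable
  then show ?thesis
    using assms by (simp add: max_absorb2)
qed

text \<open>Equality would force S(1) = 0 almost surely, against strict increase from S(0) =
  0.\<close>

lemma lap_less_1: "lap 1 1 < 1"
proof (rule ccontr)
  assume "\<not> lap 1 1 < 1"
  moreover have "lap 1 1 \<le> 1"
    using lap_mono[of 1 0 1] by simp
  ultimately have "(\<integral>\<omega>. 1 - exp (- 1 * S 1 \<omega>) \<partial>M) = 0"
    using integrable_lap[of 1 1] by (simp add: lap_def prob_space)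
  moreover have "AE \<omega> in M. 0 \<le> 1 - exp (- 1 * S 1 \<omega>)"
    using AE_S_nonneg by eventually_elim simp
  ultimately have "AE \<omega> in M. 1 - exp (- 1 * S 1 \<omega>) = 0"
    using integrable_lap[of 1 1] by (subst (asm) integral_nonneg_eq_0_iff_AE) auto
  then have "AE \<omega> in M. False"
    using strict AE_S_zero
  proof eventually_elim
    case (elim \<omega>)
    then show False
      using strict_mono_onD[of "{0..}" "\<lambda>t. S t \<omega>" 0 1] by simp
  qed
  then show False
    by (simp add: AE_False)
qed

text \<open>The sum over n of exp(-S(n)) has a geometric series with ratio \<open>lap 1 1\<close> <
  1 as its expectation. It is therefore finite almost surely, so its terms tend to 0.\<close>

lemma AE_S_unbounded: "AE \<omega> in M. \<forall>c. \<exists>u\<ge>0. c < S u \<omega>"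
proof -
  have [measurable]: "\<And>n. S (real n) \<in> borel_measurable M"
    by (rule measurable_S) simp
  have "(\<integral>\<^sup>+\<omega>. (\<Sum>n. ennreal (exp (- 1 * S (real n) \<omega>))) \<partial>M) = (\<Sum>n. ennreal (lap (real n) 1))"
    by (subst nn_integral_suminf) (measurable, simp only: nn_integral_lap of_nat_0_le_iff zero_le_one)
  also have "\<dots> = (\<Sum>n. ennreal (lap 1 1 ^ n))"
    using lap_power[of 1 _ 1] by simp
  also have "\<dots> \<noteq> \<infinity>"
    using lap_less_1 lap_pos[of 1 1] by (subst suminf_ennreal2) auto
  finally have "AE \<omega> in M. (\<Sum>n. ennreal (exp (- 1 * S (real n) \<omega>))) \<noteq> \<infinity>"
    by (intro nn_integral_noteq_infinite) auto
  then show ?thesis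
  proof eventually_elim
    case (elim \<omega>)
    then have "summable (\<lambda>n. exp (- 1 * S (real n) \<omega>))"
      by (intro summable_suminf_not_top) auto
    then have "(\<lambda>n. exp (- 1 * S (real n) \<omega>)) \<longlonglongrightarrow> 0"
      by (rule summable_LIMSEQ_zero)
    then have "\<exists>n. exp (- 1 * S (real n) \<omega>) < exp (- c)" for c
      using order_tendstoD(2)[of _ 0 sequentially "exp (- c)"] eventually_happens'[OF sequentially_bot]
      by (metis exp_gt_zero)
    then have "\<exists>n. c < S (real n) \<omega>" for c
      by simp
    then show ?case
      by (metis of_nat_0_le_iff)
  qed
qed

lemma AE_regular_path: "AE \<omega> in M. regular_path (\<lambda>u. S u \<omega>)"
proof -
  have "AE \<omega> in M. cadlag (\<lambda>t. S t \<omega>)"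
    using subordinator by (simp add: subordinator_def levy_process_def cadlag_process_def)
  then show ?thesis
    using AE_S_zero strict AE_S_unbounded
    by eventually_elim (auto simp: regular_path_def cadlag_def)
qed

end

section \<open>The exponential formula for integrands independent of the subordinator\<close>

text \<open>The points where \<open>f\<close> and \<open>g\<close> differ lie in a null set, so all
  their subsets are measurable for the completion; the event for \<open>g\<close> is the event for
  \<open>f\<close> corrected by two such subsets.\<close>

lemma borel_measurable_completion_AE:
  assumes [measurable]: "f \<in> measurable (completion M) N"
    and ae: "AE x in M. f x = g x" and space: "\<And>x. x \<in> space M \<Longrightarrow> g x \<in> space N"
  shows "g \<in> measurable (completion M) N"
proof (rule measurableI)
  fix A assume [measurable]: "A \<in> sets N"
  have [measurable]: "Measurable.pred (completion M) (\<lambda>x. g x \<in> A \<and> f x \<noteq> g x)"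
    "Measurable.pred (completion M) (\<lambda>x. f x \<in> A \<and> f x \<noteq> g x)"
    using ae by (auto intro!: sets_completion_AE elim!: AE_mp)
  have "Measurable.pred (completion M) (\<lambda>x. (f x \<in> A \<and> \<not> (f x \<in> A \<and> f x \<noteq> g x)) \<or> (g x \<in> A \<and> f x \<noteq> g x))"
    by measurable
  moreover have "(f x \<in> A \<and> \<not> (f x \<in> A \<and> f x \<noteq> g x)) \<or> (g x \<in> A \<and> f x \<noteq> g x) \<longleftrightarrow> g x \<in> A" for x
    by auto
  ultimately show "g -` A \<inter> space (completion M) \<in> sets (completion M)"
    by (simp add: pred_def vimage_def Int_def conj_commute)
qed (use space in simp)

lemma borel_measurable_completion_LIMSEQ:
  fixes f :: "nat \<Rightarrow> 'a \<Rightarrow> ennreal"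
  assumes [measurable]: "\<And>m. f m \<in> borel_measurable (completion M)"
    and "AE x in M. (\<lambda>m. f m x) \<longlonglongrightarrow> g x"
  shows "g \<in> borel_measurable (completion M)"
proof (rule borel_measurable_completion_AE)
  show "(\<lambda>x. liminf (\<lambda>m. f m x)) \<in> borel_measurable (completion M)"
    by measurable
  show "AE x in M. liminf (\<lambda>m. f m x) = g x"
    using assms(2) by eventually_elim (simp add: lim_imp_Liminf)
qed simp

text \<open>Equal to \<open>x\<close> on the positive reals if \<open>x\<close> is right-continuous, but jointly measurable in \<open>x\<close> and \<open>u\<close>.\<close>

definition right_lim :: "(real \<Rightarrow> real) \<Rightarrow> real \<Rightarrow> real" where
  "right_lim x u = lim (\<lambda>n. x ((real (cell (Suc n) u) + 1) / real (Suc n)))"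

lemma tendsto_right_grid:
  assumes "(x \<longlongrightarrow> x u) (at_right u)" "0 < u"
  shows "(\<lambda>n. x ((real (cell (Suc n) u) + 1) / real (Suc n))) \<longlonglongrightarrow> x u"
proof -
  \<comment> \<open>A right endpoint may coincide with u, so the limit is taken within
    \<open>{u..}\<close> and not in the punctured filter \<open>at_right u\<close>.\<close>
  have "continuous (at u within {u..}) x"
    using assms(1) by (simp add: continuous_within at_within_Ici_at_right)
  moreover have "(real (cell (Suc n) u) + 1) / real (Suc n) \<in> {u..}" for n
    using cell_bounds(2)[OF zero_less_Suc assms(2), of n] by simp
  ultimately show ?thesis
    using cell_tendsto(2)[OF assms(2)] by (auto simp: continuous_within_sequentially o_def)
qed

lemma right_lim_eq:
  assumes "(x \<longlongrightarrow> x u) (at_right u)" "0 < u"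
  shows "right_lim x u = x u"
  unfolding right_lim_def using tendsto_right_grid[OF assms] by (rule limI)

text \<open>For fixed n, the coordinate at which the path is read depends on u through the countably
  many values of \<open>cell\<close> only, which makes each approximation jointly
  measurable.\<close>

lemma measurable_right_lim [measurable]:
  "(\<lambda>(x, u). right_lim x u) \<in> borel_measurable (path_space \<Otimes>\<^sub>M borel)"
proof -
  have "(\<lambda>p. fst p ((real (cell (Suc n) (snd p)) + 1) / real (Suc n))) \<in> borel_measurable (path_space \<Otimes>\<^sub>M borel)" for n
    by (rule measurable_compose_countable[where f = "\<lambda>k p. fst p ((real k + 1) / real (Suc n))"])
      (auto intro!: measurable_compose[OF measurable_fst measurable_component_singleton])
  then show ?thesis
    unfolding right_lim_def split_beta by (rule borel_measurable_lim_metric)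
qed

text \<open>Left endpoints lie strictly below u, so for u \<le> a every term is 1; for a < u they
  eventually pass a. Right endpoints could fail at u = a.\<close>

lemma tendsto_left_grid_less:
  assumes "0 < u"
  shows "(\<lambda>n. of_bool (ennreal (real (cell (Suc n) u) / real (Suc n)) < a) :: real)
    \<longlonglongrightarrow> of_bool (ennreal u \<le> a)"
proof (rule tendsto_eventually)
  have *: "ennreal (real (cell (Suc n) u) / real (Suc n)) < ennreal u" for n
    using cell_bounds(1)[OF zero_less_Suc assms, of n] assms by (simp add: ennreal_less_iff)
  show "\<forall>\<^sub>F n in sequentially. (of_bool (ennreal (real (cell (Suc n) u) / real (Suc n)) < a) :: real) =
      of_bool (ennreal u \<le> a)"
  proof (cases "ennreal u \<le> a")
    case True
    then show ?thesis
      using less_le_trans[OF * True] by simp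
  next
    case False
    then have "\<forall>\<^sub>F n in sequentially. a < ennreal (real (cell (Suc n) u) / real (Suc n))"
      using cell_tendsto(1)[OF assms] by (intro order_tendstoD(1)[OF tendsto_ennrealI]) auto
    then show ?thesis
      by eventually_elim (use False in auto)
  qed
qed

text \<open>S is independent of the pair (X, \<tau>), so \<tau> may depend on X in any way.\<close>

locale independent_time_change = strict_subordinator M S
  for M :: "'w measure" and S :: "real \<Rightarrow> 'w \<Rightarrow> real" +
  fixes X :: "real \<Rightarrow> 'w \<Rightarrow> real" and \<tau> :: "'w \<Rightarrow> ennreal"
  assumes cadlag_X: "cadlag_process M X"
    and indep: "indep_elements M path_space (path_on S)
           (path_space \<Otimes>\<^sub>M borel) (\<lambda>\<omega>. (path_on X \<omega>, \<tau> \<omega>))"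
begin

abbreviation Z :: "'w \<Rightarrow> (real \<Rightarrow> real) \<times> ennreal" where
  "Z \<omega> \<equiv> (path_on X \<omega>, \<tau> \<omega>)"

abbreviation S_path :: "'w \<Rightarrow> real \<Rightarrow> real" where
  "S_path \<omega> \<equiv> \<lambda>u. S u \<omega>"

lemma measurable_Z [measurable]: "Z \<in> measurable M (path_space \<Otimes>\<^sub>M borel)"
  using indep by (simp add: indep_elements_def)

lemma path_on_X: "0 \<le> u \<Longrightarrow> path_on X \<omega> u = X u \<omega>"
  by (simp add: path_on_def)

lemma AE_X_right_cont: "AE \<omega> in M. \<forall>u\<ge>0. ((\<lambda>u. X u \<omega>) \<longlongrightarrow> X u \<omega>) (at_right u)"
  using cadlag_X by (auto simp: cadlag_process_def cadlag_def elim!: AE_mp)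

text \<open>The last clause is the formula E exp(-\<integral>H dS) = E exp(-\<integral>\<phi>(H(u))
  du). Measurability and nonnegativity are bundled with it so that the whole property passes to
  limits.\<close>

definition exponential_formula :: "('w \<Rightarrow> real \<Rightarrow> real) \<Rightarrow> bool" where
  "exponential_formula H \<longleftrightarrow>
     (AE \<omega> in M. H \<omega> \<in> borel_measurable borel \<and> (\<forall>u. 0 \<le> H \<omega> u)) \<and>
     (\<lambda>\<omega>. clock_integral (S_path \<omega>) (H \<omega>)) \<in> borel_measurable (completion M) \<and>
     (\<lambda>\<omega>. clock_integral (\<lambda>u. u) (\<lambda>u. exponent (H \<omega> u))) \<in> borel_measurable (completion M) \<and>
     (\<integral>\<omega>. exp_neg (clock_integral (S_path \<omega>) (H \<omega>)) \<partial>completion M) =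
     (\<integral>\<omega>. exp_neg (clock_integral (\<lambda>u. u) (\<lambda>u. exponent (H \<omega> u))) \<partial>completion M)"

text \<open>With \<open>Z\<close> frozen, the coefficients are constants and
  \<open>nn_integral_exp_incr\<close> applies to the inner expectation.\<close>

lemma exp_incr_eq:
  assumes "0 < n" and g [measurable]: "\<And>k. g k \<in> borel_measurable (path_space \<Otimes>\<^sub>M borel)"
    and g0: "\<And>k z. 0 \<le> g k z"
  shows "(\<integral>\<^sup>+\<omega>. ennreal (exp (- (\<Sum>k<N. g k (Z \<omega>) * incr n k \<omega>))) \<partial>M) =
         (\<integral>\<^sup>+\<omega>. ennreal (exp (- (\<Sum>k<N. exponent (g k (Z \<omega>)) / n))) \<partial>M)"
proof -
  define f where "f p = ennreal (exp (- (\<Sum>k<N. g k (snd p) *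
      (fst p ((real k + 1) / n) - fst p (real k / n)))))" for p :: "(real \<Rightarrow> real) \<times> (real \<Rightarrow> real) \<times> ennreal"
  have [measurable]: "(\<lambda>p. fst p t) \<in> borel_measurable (path_space \<Otimes>\<^sub>M (path_space \<Otimes>\<^sub>M (borel :: ennreal measure)))"
    if "0 \<le> t" for t
    using that by (intro measurable_compose[OF measurable_fst measurable_component_singleton]) auto
  have f_meas: "f \<in> borel_measurable (path_space \<Otimes>\<^sub>M (path_space \<Otimes>\<^sub>M borel))"
    unfolding f_def by measurable
  have f_eq: "f (path_on S \<omega>, z) = ennreal (exp (- (\<Sum>k<N. g k z * incr n k \<omega>)))" for \<omega> z
    by (simp add: f_def path_on_def incr_def)
  have "(\<integral>\<^sup>+\<omega>. ennreal (exp (- (\<Sum>k<N. g k (Z \<omega>) * incr n k \<omega>))) \<partial>M) =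
      (\<integral>\<^sup>+\<omega>'. \<integral>\<^sup>+\<omega>. ennreal (exp (- (\<Sum>k<N. g k (Z \<omega>') * incr n k \<omega>))) \<partial>M \<partial>M)"
    using nn_integral_indep_elements[OF prob_space_axioms indep f_meas] by (simp add: f_eq)
  also have "\<dots> = (\<integral>\<^sup>+\<omega>'. ennreal (\<Prod>k<N. lap (1 / n) (g k (Z \<omega>'))) \<partial>M)"
    by (simp add: nn_integral_exp_incr g0)
  also have "\<dots> = (\<integral>\<^sup>+\<omega>. ennreal (exp (- (\<Sum>k<N. exponent (g k (Z \<omega>)) / n))) \<partial>M)"
    using \<open>0 < n\<close> by (simp add: lap_eq_exp g0 exp_sum flip: sum_negf)
  finally show ?thesis .
qed

lemma exponential_formula_step:
  assumes "0 < n" and g [measurable]: "\<And>k. g k \<in> borel_measurable (path_space \<Otimes>\<^sub>M borel)"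
    and g0: "\<And>k z. 0 \<le> g k z"
  shows "exponential_formula (\<lambda>\<omega>. step_fun n N (\<lambda>k. g k (Z \<omega>)))"
proof -
  have [measurable]: "(\<lambda>z. exponent (g k z)) \<in> borel_measurable (path_space \<Otimes>\<^sub>M borel)" for k
    using g0 by (intro borel_measurable_exponent) auto
  have step_nonneg: "0 \<le> step_fun n N (\<lambda>k. g k (Z \<omega>)) u" for \<omega> u
    using g0 by (simp add: step_fun_def)
  let ?I = "\<lambda>\<omega>. clock_integral (S_path \<omega>) (step_fun n N (\<lambda>k. g k (Z \<omega>)))"
  let ?J = "\<lambda>\<omega>. clock_integral (\<lambda>u. u) (\<lambda>u. exponent (step_fun n N (\<lambda>k. g k (Z \<omega>)) u))"
  have I_eq: "AE \<omega> in M. ennreal (\<Sum>k<N. g k (Z \<omega>) * incr n k \<omega>) = ?I \<omega>"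
    using AE_regular_path
    by eventually_elim (simp add: clock_integral_step_fun \<open>0 < n\<close> g0 incr_def)
  have J_eq: "?J \<omega> = ennreal (\<Sum>k<N. exponent (g k (Z \<omega>)) / n)" for \<omega>
  proof -
    \<comment> \<open>As \<phi>(0) = 0, applying \<phi> to a step function gives a step function
      with the same support.\<close>
    have "(\<lambda>u. exponent (step_fun n N (\<lambda>k. g k (Z \<omega>)) u)) = step_fun n N (\<lambda>k. exponent (g k (Z \<omega>)))"
      by (auto simp: step_fun_def exponent_zero)
    then show ?thesis
      by (simp add: clock_integral_step_fun[OF regular_path_id \<open>0 < n\<close>] exponent_nonneg g0 add_divide_distrib)
  qed
  have "(\<lambda>\<omega>. ennreal (\<Sum>k<N. g k (Z \<omega>) * incr n k \<omega>)) \<in> borel_measurable (completion M)"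
    by (intro measurable_completion) measurable
  then have I_meas: "?I \<in> borel_measurable (completion M)"
    by (rule borel_measurable_completion_AE[OF _ I_eq]) simp
  have J_meas: "?J \<in> borel_measurable (completion M)"
    unfolding J_eq by (intro measurable_completion) measurable
  have "(\<integral>\<omega>. exp_neg (?I \<omega>) \<partial>completion M) = enn2real (\<integral>\<^sup>+\<omega>. ennreal (exp_neg (?I \<omega>)) \<partial>completion M)"
    using I_meas by (intro integral_eq_nn_integral) auto
  also have "(\<integral>\<^sup>+\<omega>. ennreal (exp_neg (?I \<omega>)) \<partial>completion M) =
      (\<integral>\<^sup>+\<omega>. ennreal (exp (- (\<Sum>k<N. g k (Z \<omega>) * incr n k \<omega>))) \<partial>M)"
    unfolding nn_integral_completion
  proof (rule nn_integral_cong_AE)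
    show "AE \<omega> in M. ennreal (exp_neg (?I \<omega>)) = ennreal (exp (- (\<Sum>k<N. g k (Z \<omega>) * incr n k \<omega>)))"
      using I_eq AE_regular_path
    proof eventually_elim
      case (elim \<omega>)
      \<comment> \<open>The sign matters because \<open>ennreal\<close> sends negative reals to 0,
        where \<open>exp_neg\<close> would no longer agree with \<open>exp\<close>.\<close>
      have "0 \<le> (\<Sum>k<N. g k (Z \<omega>) * incr n k \<omega>)"
        using regular_path_mono[OF elim(2)] g0
        by (intro sum_nonneg mult_nonneg_nonneg) (auto simp: incr_def divide_right_mono)
      then show ?case
        by (simp flip: elim(1))
    qed
  qed
  also have "\<dots> = (\<integral>\<^sup>+\<omega>. ennreal (exp (- (\<Sum>k<N. exponent (g k (Z \<omega>)) / n))) \<partial>M)"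
    by (rule exp_incr_eq[OF assms])
  also have "\<dots> = (\<integral>\<^sup>+\<omega>. ennreal (exp_neg (?J \<omega>)) \<partial>completion M)"
    unfolding J_eq nn_integral_completion
    by (intro nn_integral_cong) (simp add: exponent_nonneg g0 sum_nonneg)
  also have "enn2real \<dots> = (\<integral>\<omega>. exp_neg (?J \<omega>) \<partial>completion M)"
    using J_meas by (intro integral_eq_nn_integral[symmetric]) auto
  finally show ?thesis
    unfolding exponential_formula_def using I_meas J_meas step_nonneg
    by (intro conjI AE_I2 allI borel_measurable_step_fun)
qed

text \<open>\<open>exp_neg\<close> is continuous and bounded by 1, so the outer expectations
  converge as soon as both inner integrals do almost surely; each application supplies that
  convergence.\<close>

lemma exponential_formula_limit:
  assumes H: "\<And>m. exponential_formula (H m)"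
    and lim: "AE \<omega> in M. \<forall>u. (\<lambda>m. H m \<omega> u) \<longlonglongrightarrow> H' \<omega> u"
    and limI: "AE \<omega> in M. (\<lambda>m. clock_integral (S_path \<omega>) (H m \<omega>)) \<longlonglongrightarrow> clock_integral (S_path \<omega>) (H' \<omega>)"
    and limJ: "AE \<omega> in M. (\<lambda>m. clock_integral (\<lambda>u. u) (\<lambda>u. exponent (H m \<omega> u)))
        \<longlonglongrightarrow> clock_integral (\<lambda>u. u) (\<lambda>u. exponent (H' \<omega> u))"
  shows "exponential_formula H'"
proof -
  interpret C: prob_space "completion M"
    by (rule prob_spaceI) (simp add: emeasure_space_1)
  have "AE \<omega> in M. \<forall>m. H m \<omega> \<in> borel_measurable borel \<and> (\<forall>u. 0 \<le> H m \<omega> u)"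
    using H by (auto simp: exponential_formula_def AE_all_countable)
  then have 1: "AE \<omega> in M. H' \<omega> \<in> borel_measurable borel \<and> (\<forall>u. 0 \<le> H' \<omega> u)"
    using lim
  proof eventually_elim
    case (elim \<omega>)
    have "H' \<omega> \<in> borel_measurable borel"
      by (rule borel_measurable_LIMSEQ_metric[of "\<lambda>m. H m \<omega>"]) (use elim in simp_all)
    moreover have "0 \<le> H' \<omega> u" for u
      by (rule LIMSEQ_le_const[of "\<lambda>m. H m \<omega> u"]) (use elim in simp_all)
    ultimately show ?case
      by simp
  qed
  have H_meas: "(\<lambda>\<omega>. clock_integral (S_path \<omega>) (H m \<omega>)) \<in> borel_measurable (completion M)"
      "(\<lambda>\<omega>. clock_integral (\<lambda>u. u) (\<lambda>u. exponent (H m \<omega> u))) \<in> borel_measurable (completion M)" for m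
    using H by (auto simp: exponential_formula_def)
  have 2: "(\<lambda>\<omega>. clock_integral (S_path \<omega>) (H' \<omega>)) \<in> borel_measurable (completion M)"
      "(\<lambda>\<omega>. clock_integral (\<lambda>u. u) (\<lambda>u. exponent (H' \<omega> u))) \<in> borel_measurable (completion M)"
    by (rule borel_measurable_completion_LIMSEQ[OF H_meas(1) limI])
      (rule borel_measurable_completion_LIMSEQ[OF H_meas(2) limJ])
  have exp_neg_lim: "(\<lambda>m. \<integral>\<omega>. exp_neg (f m \<omega>) \<partial>completion M) \<longlonglongrightarrow> (\<integral>\<omega>. exp_neg (f' \<omega>) \<partial>completion M)"
    if [measurable]: "\<And>m. f m \<in> borel_measurable (completion M)" "f' \<in> borel_measurable (completion M)"
      and lim: "AE \<omega> in M. (\<lambda>m. f m \<omega>) \<longlonglongrightarrow> f' \<omega>" for f f'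
  proof (rule integral_dominated_convergence[where w = "\<lambda>_. 1"])
    show "AE \<omega> in completion M. (\<lambda>m. exp_neg (f m \<omega>)) \<longlonglongrightarrow> exp_neg (f' \<omega>)"
      using AE_completion[OF lim] by eventually_elim (rule tendsto_exp_neg)
  qed auto
  have "(\<integral>\<omega>. exp_neg (clock_integral (S_path \<omega>) (H' \<omega>)) \<partial>completion M) =
     (\<integral>\<omega>. exp_neg (clock_integral (\<lambda>u. u) (\<lambda>u. exponent (H' \<omega> u))) \<partial>completion M)"
    using exp_neg_lim[OF H_meas(1) 2(1) limI] exp_neg_lim[OF H_meas(2) 2(2) limJ] H
    by (simp add: exponential_formula_def LIMSEQ_unique)
  then show ?thesis
    using 1 2 by (simp add: exponential_formula_def)
qed

lemma exponential_formula_dominated: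
  assumes H: "\<And>m. exponential_formula (H m)"
    and lim: "AE \<omega> in M. \<forall>u. (\<lambda>m. H m \<omega> u) \<longlonglongrightarrow> H' \<omega> u"
    and bound: "AE \<omega> in M. \<forall>m u. H m \<omega> u \<le> C * indicator {0<..T} u" and CT: "0 \<le> C" "0 \<le> T"
  shows "exponential_formula H'"
proof (rule exponential_formula_limit[OF H lim])
  have H': "AE \<omega> in M. \<forall>m. H m \<omega> \<in> borel_measurable borel \<and> (\<forall>u. 0 \<le> H m \<omega> u)"
    using H by (auto simp: exponential_formula_def AE_all_countable)
  show "AE \<omega> in M. (\<lambda>m. clock_integral (S_path \<omega>) (H m \<omega>)) \<longlonglongrightarrow> clock_integral (S_path \<omega>) (H' \<omega>)"
    using AE_regular_path lim bound H'
  proof eventually_elim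
    case (elim \<omega>)
    then show ?case
      using CT by (intro clock_integral_dominated[where C = C and T = T]) auto
  qed
  show "AE \<omega> in M. (\<lambda>m. clock_integral (\<lambda>u. u) (\<lambda>u. exponent (H m \<omega> u)))
        \<longlonglongrightarrow> clock_integral (\<lambda>u. u) (\<lambda>u. exponent (H' \<omega> u))"
    using lim bound H'
  proof eventually_elim
    case (elim \<omega>)
    show ?case
    proof (intro clock_integral_dominated[OF regular_path_id, where C = "exponent C" and T = T]
        borel_measurable_exponent exponent_tendsto)
      \<comment> \<open>Inside the support the bound is monotonicity of \<phi>; outside,
        \<open>H m\<close> is squeezed to 0 and \<phi>(0) = 0.\<close>
      show "exponent (H m \<omega> u) \<le> exponent C * indicator {0<..T} u" for m u
      proof (cases "u \<in> {0<..T}")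
        case True
        then show ?thesis
          using elim(2)[rule_format, of m u] elim(3) CT
          by (auto intro: mono_onD[OF exponent_mono])
      next
        case False
        then have "H m \<omega> u = 0"
          using elim(2)[rule_format, of m u] elim(3) by (auto intro: antisym)
        then show ?thesis
          using False by (simp add: exponent_zero)
      qed
    qed (use elim CT exponent_nonneg in auto)
  qed
qed

lemma exponential_formula_monotone:
  assumes H: "\<And>m. exponential_formula (H m)"
    and lim: "AE \<omega> in M. \<forall>u. (\<lambda>m. H m \<omega> u) \<longlonglongrightarrow> H' \<omega> u"
    and inc: "\<And>m m' \<omega> u. m \<le> m' \<Longrightarrow> H m \<omega> u \<le> H m' \<omega> u"
  shows "exponential_formula H'"
proof (rule exponential_formula_limit[OF H lim])
  have H': "AE \<omega> in M. \<forall>m. H m \<omega> \<in> borel_measurable borel \<and> (\<forall>u. 0 \<le> H m \<omega> u)"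
    using H by (auto simp: exponential_formula_def AE_all_countable)
  show "AE \<omega> in M. (\<lambda>m. clock_integral (S_path \<omega>) (H m \<omega>)) \<longlonglongrightarrow> clock_integral (S_path \<omega>) (H' \<omega>)"
    using AE_regular_path lim H'
  proof eventually_elim
    case (elim \<omega>)
    then show ?case
      using inc by (intro clock_integral_monotone) auto
  qed
  show "AE \<omega> in M. (\<lambda>m. clock_integral (\<lambda>u. u) (\<lambda>u. exponent (H m \<omega> u)))
        \<longlonglongrightarrow> clock_integral (\<lambda>u. u) (\<lambda>u. exponent (H' \<omega> u))"
    using lim H'
  proof eventually_elim
    case (elim \<omega>)
    then show ?case
      using inc
      by (intro clock_integral_monotone[OF regular_path_id] borel_measurable_exponent exponent_tendsto
          mono_onD[OF exponent_mono]) auto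
  qed
qed

text \<open>\<open>G n k\<close> is the value on cell k of the grid of mesh 1/(n+1). The uniform
  bound and the finite horizon provide a dominating function.\<close>

lemma exponential_formula_grid:
  fixes T :: nat
  assumes G [measurable]: "\<And>n k. G n k \<in> borel_measurable (path_space \<Otimes>\<^sub>M borel)"
    and G0: "\<And>n k z. 0 \<le> G n k z" and GC: "\<And>n k z. G n k z \<le> C"
    and lim: "AE \<omega> in M. \<forall>u. 0 < u \<longrightarrow> u \<le> real T \<longrightarrow> (\<lambda>n. G n (cell (Suc n) u) (Z \<omega>)) \<longlonglongrightarrow> H \<omega> u"
  shows "exponential_formula (\<lambda>\<omega> u. of_bool (0 < u \<and> u \<le> real T) * H \<omega> u)"
proof (rule exponential_formula_dominated)
  show "exponential_formula (\<lambda>\<omega>. step_fun (Suc n) (Suc n * T) (\<lambda>k. G n k (Z \<omega>)))" for n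
    by (intro exponential_formula_step G G0) simp
  have step: "step_fun (Suc n) (Suc n * T) g u = of_bool (0 < u \<and> u \<le> real T) * g (cell (Suc n) u)" for n g u
    using cell_less_iff[of "Suc n" u T] by (auto simp: step_fun_def)
  show "AE \<omega> in M. \<forall>u. (\<lambda>n. step_fun (Suc n) (Suc n * T) (\<lambda>k. G n k (Z \<omega>)) u)
      \<longlonglongrightarrow> of_bool (0 < u \<and> u \<le> real T) * H \<omega> u"
    using lim by eventually_elim (auto simp: step simp del: mult_Suc)
  show "AE \<omega> in M. \<forall>n u. step_fun (Suc n) (Suc n * T) (\<lambda>k. G n k (Z \<omega>)) u \<le> C * indicator {0<..real T} u"
    using GC by (auto simp: step simp del: mult_Suc)
  show "0 \<le> C"
    using G0 GC by (rule order.trans)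
qed simp

text \<open>Monotone convergence in the horizon; both integrals may become infinite.\<close>

lemma exponential_formula_untruncate:
  assumes "\<And>T::nat. exponential_formula (\<lambda>\<omega> u. of_bool (0 < u \<and> u \<le> real T) * H \<omega> u)"
    and H0: "\<And>\<omega> u. 0 \<le> H \<omega> u"
  shows "exponential_formula (\<lambda>\<omega> u. of_bool (0 < u) * H \<omega> u)"
proof (rule exponential_formula_monotone[OF assms(1)])
  have "(\<lambda>T::nat. of_bool (0 < u \<and> u \<le> real T) * H \<omega> u) \<longlonglongrightarrow> of_bool (0 < u) * H \<omega> u" for \<omega> u
  proof (intro tendsto_eventually)
    have "\<forall>\<^sub>F T in sequentially. u \<le> real T"
      by (meson eventually_sequentiallyI nat_ceiling_le_eq)
    then show "\<forall>\<^sub>F T in sequentially. of_bool (0 < u \<and> u \<le> real T) * H \<omega> u = of_bool (0 < u) * H \<omega> u"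
      by eventually_elim simp
  qed
  then show "AE \<omega> in M. \<forall>u. (\<lambda>T::nat. of_bool (0 < u \<and> u \<le> real T) * H \<omega> u) \<longlonglongrightarrow> of_bool (0 < u) * H \<omega> u"
    by simp
  show "of_bool (0 < u \<and> u \<le> real T) * H \<omega> u \<le> of_bool (0 < u \<and> u \<le> real T') * H \<omega> u"
    if "T \<le> T'" for T T' :: nat and \<omega> u
    using H0[of \<omega> u] that by auto
qed

text \<open>The integrand that yields A*. For fixed \<open>j\<close>, the grid limit passes through
  the continuous ramp; the indicator of X(u) \<le> v appears only as \<open>j\<close> tends to
  infinity, since values of X above v may converge to v.\<close>

lemma exponential_formula_levels:
  fixes k :: "real \<Rightarrow> real"
  assumes "finite J" and k: "\<And>v. 0 \<le> k v"
  shows "exponential_formula (\<lambda>\<omega> u. of_bool (0 < u) *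
    (\<Sum>v\<in>J. k v * of_bool (ennreal u \<le> \<tau> \<omega> \<and> X u \<omega> \<le> v)))"
proof (rule exponential_formula_untruncate)
  fix T :: nat
  define H where "H j \<omega> u = of_bool (0 < u \<and> u \<le> real T) *
      (of_bool (ennreal u \<le> \<tau> \<omega>) * (\<Sum>v\<in>J. k v * ramp j (X u \<omega> - v)))" for j \<omega> u
  have ramp_sum: "0 \<le> (\<Sum>v\<in>J. k v * ramp j (y - v))" "(\<Sum>v\<in>J. k v * ramp j (y - v)) \<le> (\<Sum>v\<in>J. k v)" for j y
    using k ramp_bounds by (auto intro!: sum_nonneg sum_mono mult_left_le)
  have "exponential_formula (H j)" for j
    unfolding H_def[abs_def]
  proof (rule exponential_formula_grid)
    \<comment> \<open>The two factors read opposite ends of the same cell: left for \<tau>, right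
      for X.\<close>
    let ?G = "\<lambda>n i z. of_bool (ennreal (real i / real (Suc n)) < snd z) *
        (\<Sum>v\<in>J. k v * ramp j (fst z ((real i + 1) / real (Suc n)) - v))"
    have [measurable]: "(\<lambda>z. fst z t) \<in> borel_measurable (path_space \<Otimes>\<^sub>M (borel :: ennreal measure))"
      if "0 \<le> t" for t
      using that by (intro measurable_compose[OF measurable_fst measurable_component_singleton]) auto
    show "?G n i \<in> borel_measurable (path_space \<Otimes>\<^sub>M borel)" for n i
      by measurable
    show "0 \<le> ?G n i z" "?G n i z \<le> (\<Sum>v\<in>J. k v)" for n i z
      using ramp_sum[of j "fst z ((real i + 1) / real (Suc n))"] by (auto intro: order.trans)
    show "AE \<omega> in M. \<forall>u. 0 < u \<longrightarrow> u \<le> real T \<longrightarrow> (\<lambda>n. ?G n (cell (Suc n) u) (Z \<omega>)) \<longlonglongrightarrow>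
        of_bool (ennreal u \<le> \<tau> \<omega>) * (\<Sum>v\<in>J. k v * ramp j (X u \<omega> - v))"
      using AE_X_right_cont
    proof (eventually_elim, intro allI impI)
      fix \<omega> and u :: real assume *: "\<forall>u\<ge>0. ((\<lambda>u. X u \<omega>) \<longlongrightarrow> X u \<omega>) (at_right u)" and "0 < u"
      have "(\<lambda>n. X ((real (cell (Suc n) u) + 1) / real (Suc n)) \<omega>) \<longlonglongrightarrow> X u \<omega>"
        using * \<open>0 < u\<close> by (intro tendsto_right_grid[of "\<lambda>u. X u \<omega>"]) auto
      then have "(\<lambda>n. of_bool (ennreal (real (cell (Suc n) u) / real (Suc n)) < \<tau> \<omega>) *
          (\<Sum>v\<in>J. k v * ramp j (X ((real (cell (Suc n) u) + 1) / real (Suc n)) \<omega> - v))) \<longlonglongrightarrow>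
          of_bool (ennreal u \<le> \<tau> \<omega>) * (\<Sum>v\<in>J. k v * ramp j (X u \<omega> - v))"
        using \<open>0 < u\<close>
        by (intro tendsto_mult tendsto_left_grid_less tendsto_sum tendsto_const tendsto_diff
            isCont_tendsto_compose[OF isCont_ramp])
      then show "(\<lambda>n. ?G n (cell (Suc n) u) (Z \<omega>)) \<longlonglongrightarrow>
        of_bool (ennreal u \<le> \<tau> \<omega>) * (\<Sum>v\<in>J. k v * ramp j (X u \<omega> - v))"
        by (simp add: path_on_X)
    qed
  qed
  then show "exponential_formula (\<lambda>\<omega> u. of_bool (0 < u \<and> u \<le> real T) *
      (\<Sum>v\<in>J. k v * of_bool (ennreal u \<le> \<tau> \<omega> \<and> X u \<omega> \<le> v)))"
  proof (rule exponential_formula_dominated)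
    have "(\<lambda>j. H j \<omega> u) \<longlonglongrightarrow> of_bool (0 < u \<and> u \<le> real T) *
        (of_bool (ennreal u \<le> \<tau> \<omega>) * (\<Sum>v\<in>J. k v * of_bool (X u \<omega> - v \<le> 0)))" for \<omega> u
      unfolding H_def by (intro tendsto_mult tendsto_sum tendsto_const ramp_tendsto)
    moreover have "of_bool (ennreal u \<le> \<tau> \<omega>) * (\<Sum>v\<in>J. k v * of_bool (X u \<omega> - v \<le> 0)) =
        (\<Sum>v\<in>J. k v * of_bool (ennreal u \<le> \<tau> \<omega> \<and> X u \<omega> \<le> v))" for \<omega> u
      by (cases "ennreal u \<le> \<tau> \<omega>") auto
    ultimately show "AE \<omega> in M. \<forall>u. (\<lambda>j. H j \<omega> u) \<longlonglongrightarrow> of_bool (0 < u \<and> u \<le> real T) *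
        (\<Sum>v\<in>J. k v * of_bool (ennreal u \<le> \<tau> \<omega> \<and> X u \<omega> \<le> v))"
      by simp
    show "AE \<omega> in M. \<forall>j u. H j \<omega> u \<le> (\<Sum>v\<in>J. k v) * indicator {0<..real T} u"
      using ramp_sum k by (auto simp: H_def indicator_def sum_nonneg)
  qed (use k in \<open>auto intro: sum_nonneg\<close>)
qed (use k in \<open>auto intro: sum_nonneg\<close>)

text \<open>The integrand that yields S(A(v)), with \<open>a v\<close> to be \<open>occ v\<close>.
  Left endpoints converge directly to the indicators of random initial segments, and dependence on
  \<open>Z\<close> alone supplies the independence from S.\<close>

lemma exponential_formula_initial:
  fixes k :: "real \<Rightarrow> real" and a :: "real \<Rightarrow> (real \<Rightarrow> real) \<times> ennreal \<Rightarrow> ennreal"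
  assumes "finite J" and k: "\<And>v. 0 \<le> k v"
    and a [measurable]: "\<And>v. a v \<in> borel_measurable (path_space \<Otimes>\<^sub>M borel)"
  shows "exponential_formula (\<lambda>\<omega> u. of_bool (0 < u) * (\<Sum>v\<in>J. k v * of_bool (ennreal u \<le> a v (Z \<omega>))))"
proof (rule exponential_formula_untruncate)
  fix T :: nat
  show "exponential_formula (\<lambda>\<omega> u. of_bool (0 < u \<and> u \<le> real T) *
      (\<Sum>v\<in>J. k v * of_bool (ennreal u \<le> a v (Z \<omega>))))"
  proof (rule exponential_formula_grid)
    let ?G = "\<lambda>n i z. \<Sum>v\<in>J. k v * of_bool (ennreal (real i / real (Suc n)) < a v z)"
    show "?G n i \<in> borel_measurable (path_space \<Otimes>\<^sub>M borel)" for n i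
      by measurable
    show "0 \<le> ?G n i z" "?G n i z \<le> (\<Sum>v\<in>J. k v)" for n i z
      using k by (auto intro!: sum_nonneg sum_mono)
    show "AE \<omega> in M. \<forall>u. 0 < u \<longrightarrow> u \<le> real T \<longrightarrow> (\<lambda>n. ?G n (cell (Suc n) u) (Z \<omega>)) \<longlonglongrightarrow>
        (\<Sum>v\<in>J. k v * of_bool (ennreal u \<le> a v (Z \<omega>)))"
      by (intro AE_I2 allI impI tendsto_sum tendsto_mult tendsto_const tendsto_left_grid_less)
  qed
qed (use k in \<open>auto intro: sum_nonneg\<close>)

end

section \<open>Occupation times\<close>

text \<open>Occupation sets may contain time 0, which the clock sets exclude. Only the reduced set
  is known to be Borel.\<close>

lemma emeasure_lborel_remove:
  assumes "A - {x} \<in> sets borel"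
  shows "emeasure lborel A = emeasure lborel (A - {x :: real})"
proof (cases "x \<in> A")
  case True
  have "emeasure lborel (insert x (A - {x})) = emeasure lborel {x} + emeasure lborel (A - {x})"
    using assms by (intro emeasure_insert) auto
  then show ?thesis
    using True by (simp add: insert_absorb)
qed simp

lemma emeasure_lborel_initial: "emeasure lborel {t. 0 < t \<and> ennreal t \<le> b} = b"
proof (cases b)
  case (real r)
  then have "{t. 0 < t \<and> ennreal t \<le> b} = {0<..r}"
    by (auto simp: ennreal_le_iff)
  then show ?thesis
    using real by simp
next
  case top
  have "emeasure lborel {0::real<..} = \<infinity>"
  proof (rule ccontr)
    assume "emeasure lborel {0::real<..} \<noteq> \<infinity>"
    then obtain n where "emeasure lborel {0::real<..} < of_nat n"
      using ennreal_Ex_less_of_nat by (auto simp: less_top)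
    also have "of_nat n = emeasure lborel {0<..real n}"
      by (simp add: ennreal_of_nat_eq_real_of_nat)
    also have "\<dots> \<le> emeasure lborel {0::real<..}"
      by (intro emeasure_mono) auto
    finally show False
      by simp
  qed
  then show ?thesis
    using top by (simp add: greaterThan_def)
qed

lemma clock_integral_sum_of_bool:
  assumes s: "regular_path s" and k: "\<And>v. 0 \<le> k v" and B: "\<And>v. B v \<in> sets borel"
  shows "clock_integral s (\<lambda>u. \<Sum>v\<in>J. k v * of_bool (u \<in> B v)) =
    (\<Sum>v\<in>J. ennreal (k v) * emeasure lborel (clock s -` B v))"
proof -
  note [measurable] = borel_measurable_clock[OF s] B
  have "ennreal (\<Sum>v\<in>J. k v * of_bool (u \<in> B v)) = (\<Sum>v\<in>J. ennreal (k v) * indicator (B v) u)" for u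
  proof -
    have "(\<Sum>v\<in>J. ennreal (k v) * indicator (B v) u) = (\<Sum>v\<in>J. ennreal (k v * of_bool (u \<in> B v)))"
      by (intro sum.cong) (auto simp: indicator_def)
    also have "\<dots> = ennreal (\<Sum>v\<in>J. k v * of_bool (u \<in> B v))"
      using k by (intro sum_ennreal) auto
    finally show ?thesis
      by simp
  qed
  then have "clock_integral s (\<lambda>u. \<Sum>v\<in>J. k v * of_bool (u \<in> B v)) =
      (\<Sum>v\<in>J. \<integral>\<^sup>+t. ennreal (k v) * indicator (B v) (clock s t) \<partial>lborel)"
    by (simp only: clock_integral_def) (intro nn_integral_sum, measurable)
  also have "\<dots> = (\<Sum>v\<in>J. ennreal (k v) * emeasure lborel (clock s -` B v))"
  proof (intro sum.cong refl)
    fix v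
    have "clock s -` B v \<in> sets lborel"
      using measurable_sets[OF borel_measurable_clock[OF s] B[of v]] by simp
    moreover have "indicator (B v) (clock s t) = (indicator (clock s -` B v) t :: ennreal)" for t
      by (simp add: indicator_def)
    ultimately show "(\<integral>\<^sup>+t. ennreal (k v) * indicator (B v) (clock s t) \<partial>lborel) =
        ennreal (k v) * emeasure lborel (clock s -` B v)"
      by (simp add: nn_integral_cmult_indicator)
  qed
  finally show ?thesis .
qed

section \<open>Occupation sets as functions of (X, \<tau>), and their images under the clock\<close>

context independent_time_change
begin

text \<open>Written with \<open>right_lim\<close> in order to be defined from the pair
  \<open>z\<close> alone with a measurable dependence on it; \<open>AE_level_eq\<close> returns to X
  itself.\<close>

definition level :: "real \<Rightarrow> (real \<Rightarrow> real) \<times> ennreal \<Rightarrow> real set" where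
  "level v z = {u. 0 < u \<and> ennreal u \<le> snd z \<and> right_lim (fst z) u \<le> v}"

definition occ :: "real \<Rightarrow> (real \<Rightarrow> real) \<times> ennreal \<Rightarrow> ennreal" where
  "occ v z = emeasure lborel (level v z)"

lemma sets_level:
  assumes "z \<in> space (path_space \<Otimes>\<^sub>M borel)"
  shows "level v z \<in> sets borel"
proof -
  have [measurable]: "right_lim (fst z) \<in> borel_measurable borel"
    using measurable_Pair2[OF measurable_right_lim, of "fst z"] assms
    by (auto simp: space_pair_measure)
  show ?thesis
    unfolding level_def by measurable
qed

text \<open>By Fubini from joint measurability of \<open>right_lim\<close>. This qualifies
  \<open>occ v\<close> as a threshold in \<open>exponential_formula_initial\<close>.\<close>

lemma measurable_occ [measurable]: "occ v \<in> borel_measurable (path_space \<Otimes>\<^sub>M borel)"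
proof -
  have [measurable]: "(\<lambda>p. right_lim (fst (fst p)) (snd p)) \<in>
      borel_measurable ((path_space \<Otimes>\<^sub>M (borel :: ennreal measure)) \<Otimes>\<^sub>M lborel)"
    using measurable_compose[OF _ measurable_right_lim,
        of "\<lambda>p. (fst (fst p), snd p)" "(path_space \<Otimes>\<^sub>M borel) \<Otimes>\<^sub>M lborel"]
    by (simp add: split_beta)
  have "(\<lambda>z. \<integral>\<^sup>+u. of_bool (0 < u \<and> ennreal u \<le> snd z \<and> right_lim (fst z) u \<le> v) \<partial>lborel)
      \<in> borel_measurable (path_space \<Otimes>\<^sub>M borel)"
    by measurable
  moreover have "(\<integral>\<^sup>+u. of_bool (0 < u \<and> ennreal u \<le> snd z \<and> right_lim (fst z) u \<le> v) \<partial>lborel) = occ v z"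
    if "z \<in> space (path_space \<Otimes>\<^sub>M borel)" for z
  proof -
    have "(\<integral>\<^sup>+u. indicator (level v z) u \<partial>lborel) = occ v z"
      unfolding occ_def using sets_level[OF that] by (intro nn_integral_indicator) simp
    then show ?thesis
      by (simp add: level_def indicator_def)
  qed
  ultimately show ?thesis
    by (simp cong: measurable_cong)
qed

lemma space_Z: "Z \<omega> \<in> space (path_space \<Otimes>\<^sub>M borel)"
  by (auto simp: space_pair_measure space_PiM path_on_def)

lemma occ_mono: "v \<le> w \<Longrightarrow> occ v (Z \<omega>) \<le> occ w (Z \<omega>)"
  unfolding occ_def
proof (rule emeasure_mono)
  show "level v (Z \<omega>) \<subseteq> level w (Z \<omega>)" if "v \<le> w"
    using that by (auto simp: level_def)
  show "level w (Z \<omega>) \<in> sets lborel"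
    using sets_level[OF space_Z] by simp
qed

lemma AE_level_eq: "AE \<omega> in M. \<forall>v. level v (Z \<omega>) = {u. 0 < u \<and> ennreal u \<le> \<tau> \<omega> \<and> X u \<omega> \<le> v}"
  using AE_X_right_cont
proof eventually_elim
  case (elim \<omega>)
  \<comment> \<open>The limit reads positive grid times only, where \<open>path_on X\<close> agrees
    with X.\<close>
  have "right_lim (path_on X \<omega>) u = right_lim (\<lambda>u. X u \<omega>) u" for u
    by (simp add: right_lim_def path_on_X)
  then have "right_lim (path_on X \<omega>) u = X u \<omega>" if "0 < u" for u
    using right_lim_eq[of "\<lambda>u. X u \<omega>" u] elim that by simp
  then show ?case
    by (auto simp: level_def)
qed

lemma AE_occ_eq: "AE \<omega> in M. \<forall>v. occ v (Z \<omega>) = occupation X (upto_time (\<tau> \<omega>)) {..v} \<omega>"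
  using AE_level_eq
proof eventually_elim
  case (elim \<omega>)
  have "{t \<in> upto_time (\<tau> \<omega>). X t \<omega> \<in> {..v}} - {0} = level v (Z \<omega>)" for v
    using elim by (auto simp: upto_time_def)
  then show ?case
    using sets_level[OF space_Z] emeasure_lborel_remove[of "{t \<in> upto_time (\<tau> \<omega>). X t \<omega> \<in> {..v}}" 0 for v]
    by (simp add: occupation_def occ_def)
qed

lemma clock_le_eval_ext_iff:
  assumes "regular_path (S_path \<omega>)" "0 < t"
  shows "ennreal (clock (S_path \<omega>) t) \<le> a \<longleftrightarrow> ennreal t \<le> eval_ext S a \<omega>"
proof (cases a)
  case (real r)
  then show ?thesis
    using clock_le_iff[OF assms(1,2), of r] regular_path_nonneg[OF assms(1), of r]
    by (simp add: eval_ext_def ennreal_le_iff)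
qed (simp add: eval_ext_def)

lemma emeasure_clock_vimage_initial:
  assumes "regular_path (S_path \<omega>)"
  shows "emeasure lborel (clock (S_path \<omega>) -` {u. 0 < u \<and> ennreal u \<le> a}) = eval_ext S a \<omega>"
proof -
  have "clock (S_path \<omega>) -` {u. 0 < u \<and> ennreal u \<le> a} = {t. 0 < t \<and> ennreal t \<le> eval_ext S a \<omega>}"
    using clock_le_eval_ext_iff[OF assms] clock_pos_iff[OF assms] by auto
  then show ?thesis
    by (simp add: emeasure_lborel_initial)
qed

text \<open>For t > 0, t \<le> S(\<tau>) iff E(t) \<le> \<tau>, so pulling the level set back along
  the clock gives the time set of A*(v) up to time 0.\<close>

lemma AE_emeasure_clock_vimage_level:
  "AE \<omega> in M. \<forall>v. emeasure lborel (clock (S_path \<omega>) -` level v (Z \<omega>)) =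
     occupation (time_changed X S) (upto_time (eval_ext S (\<tau> \<omega>) \<omega>)) {..v} \<omega>"
  using AE_regular_path AE_level_eq
proof eventually_elim
  case (elim \<omega>)
  have eq: "{t \<in> upto_time (eval_ext S (\<tau> \<omega>) \<omega>). time_changed X S t \<omega> \<in> {..v}} - {0} =
      clock (S_path \<omega>) -` level v (Z \<omega>)" for v
  proof -
    have "clock (S_path \<omega>) t = inverse_process S t \<omega>" if "0 < t" for t
      using that by (simp add: clock_def inverse_process_def)
    then show ?thesis
      using elim(2) clock_le_eval_ext_iff[OF elim(1)] clock_pos_iff[OF elim(1)]
      by (auto simp: upto_time_def time_changed_def)
  qed
  have "clock (S_path \<omega>) -` level v (Z \<omega>) \<in> sets borel" for v
    using measurable_sets[OF borel_measurable_clock[OF elim(1)] sets_level[OF space_Z], of v] by simp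
  then show ?case
    using emeasure_lborel_remove[of "{t \<in> upto_time (eval_ext S (\<tau> \<omega>) \<omega>). time_changed X S t \<omega> \<in> {..v}}" 0 for v]
    unfolding eq by (simp add: occupation_def)
qed

text \<open>Natural weights provide exactly the mixed moments of \<open>exp_neg\<close> required by
  \<open>Laplace_imp_distr_PiM_eq\<close>.\<close>

lemma exponential_formula_occupation:
  fixes k :: "real \<Rightarrow> nat"
  assumes J: "finite J"
  defines "Y v \<omega> \<equiv> occupation (time_changed X S) (upto_time (eval_ext S (\<tau> \<omega>) \<omega>)) {..v} \<omega>"
    and "Y' v \<omega> \<equiv> eval_ext S (occupation X (upto_time (\<tau> \<omega>)) {..v} \<omega>) \<omega>"
  shows "(\<lambda>\<omega>. \<Sum>v\<in>J. of_nat (k v) * Y v \<omega>) \<in> borel_measurable (completion M)"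
    and "(\<lambda>\<omega>. \<Sum>v\<in>J. of_nat (k v) * Y' v \<omega>) \<in> borel_measurable (completion M)"
    and "(\<integral>\<omega>. exp_neg (\<Sum>v\<in>J. of_nat (k v) * Y v \<omega>) \<partial>completion M) =
         (\<integral>\<omega>. exp_neg (\<Sum>v\<in>J. of_nat (k v) * Y' v \<omega>) \<partial>completion M)"
proof -
  define H where "H \<omega> u = of_bool (0 < u) *
      (\<Sum>v\<in>J. real (k v) * of_bool (ennreal u \<le> \<tau> \<omega> \<and> X u \<omega> \<le> v))" for \<omega> u
  define H' where "H' \<omega> u = of_bool (0 < u) *
      (\<Sum>v\<in>J. real (k v) * of_bool (ennreal u \<le> occ v (Z \<omega>)))" for \<omega> u
  define I where "I v \<omega> = {u. 0 < u \<and> ennreal u \<le> occ v (Z \<omega>)}" for v \<omega>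
  have I_sets: "I v \<omega> \<in> sets borel" for v \<omega>
    unfolding I_def by measurable
  have H: "exponential_formula H"
    unfolding H_def[abs_def] using J by (intro exponential_formula_levels) auto
  have H': "exponential_formula H'"
    unfolding H'_def[abs_def] using J by (intro exponential_formula_initial) auto
  have H_eq: "AE \<omega> in M. \<forall>u. H \<omega> u = (\<Sum>v\<in>J. real (k v) * of_bool (u \<in> level v (Z \<omega>)))"
    using AE_level_eq by eventually_elim (simp add: H_def sum_distrib_left)
  have H'_eq: "H' \<omega> u = (\<Sum>v\<in>J. real (k v) * of_bool (u \<in> I v \<omega>))" for \<omega> u
    by (simp add: H'_def I_def)
  have SH: "AE \<omega> in M. clock_integral (S_path \<omega>) (H \<omega>) = (\<Sum>v\<in>J. of_nat (k v) * Y v \<omega>)"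
    using AE_regular_path H_eq AE_emeasure_clock_vimage_level
  proof eventually_elim
    case (elim \<omega>)
    then have "H \<omega> = (\<lambda>u. \<Sum>v\<in>J. real (k v) * of_bool (u \<in> level v (Z \<omega>)))"
      by blast
    then show ?case
      using elim(3) sets_level[OF space_Z]
      by (simp add: clock_integral_sum_of_bool[OF elim(1)] Y_def ennreal_of_nat_eq_real_of_nat)
  qed
  have SH': "AE \<omega> in M. clock_integral (S_path \<omega>) (H' \<omega>) = (\<Sum>v\<in>J. of_nat (k v) * Y' v \<omega>)"
    using AE_regular_path AE_occ_eq
  proof eventually_elim
    case (elim \<omega>)
    have "H' \<omega> = (\<lambda>u. \<Sum>v\<in>J. real (k v) * of_bool (u \<in> I v \<omega>))"
      using H'_eq by blast
    then have "clock_integral (S_path \<omega>) (H' \<omega>) =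
        (\<Sum>v\<in>J. ennreal (real (k v)) * emeasure lborel (clock (S_path \<omega>) -` I v \<omega>))"
      using I_sets by (simp only: clock_integral_sum_of_bool[OF elim(1)] of_nat_0_le_iff)
    then show ?case
      using elim(2) unfolding I_def
      by (simp only: emeasure_clock_vimage_initial[OF elim(1)] Y'_def ennreal_of_nat_eq_real_of_nat)
  qed
  \<comment> \<open>The pivot: one \<open>c\<close> serves both nested families, so each exponent
    integral is the sum of \<open>c v\<close> times the measure of its v-th set, and both measures
    equal \<open>occ v\<close>.\<close>
  obtain c where c: "\<And>v. 0 \<le> c v" and exponent_sum:
    "\<And>b. mono b \<Longrightarrow> exponent (\<Sum>v\<in>J. real (k v) * of_bool (b v)) = (\<Sum>v\<in>J. c v * of_bool (b v))"
    using mono_of_nested_sum[OF J, of "\<lambda>v. real (k v)" exponent] exponent_mono exponent_zero by auto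
  have JH: "AE \<omega> in M. clock_integral (\<lambda>u. u) (\<lambda>u. exponent (H \<omega> u)) =
      clock_integral (\<lambda>u. u) (\<lambda>u. exponent (H' \<omega> u))"
    using H_eq
  proof eventually_elim
    case (elim \<omega>)
    have "mono (\<lambda>v. u \<in> level v (Z \<omega>))" for u
      by (auto simp: mono_def level_def)
    then have "(\<lambda>u. exponent (H \<omega> u)) = (\<lambda>u. \<Sum>v\<in>J. c v * of_bool (u \<in> level v (Z \<omega>)))"
      using elim exponent_sum by simp
    then have "clock_integral (\<lambda>u. u) (\<lambda>u. exponent (H \<omega> u)) =
        (\<Sum>v\<in>J. ennreal (c v) * emeasure lborel (clock (\<lambda>u. u) -` level v (Z \<omega>)))"
      using sets_level[OF space_Z] c by (simp add: clock_integral_sum_of_bool[OF regular_path_id])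
    moreover have "mono (\<lambda>v. u \<in> I v \<omega>)" for u
      using occ_mono by (auto simp: mono_def I_def intro: order.trans)
    then have "(\<lambda>u. exponent (H' \<omega> u)) = (\<lambda>u. \<Sum>v\<in>J. c v * of_bool (u \<in> I v \<omega>))"
      using H'_eq exponent_sum by simp
    then have "clock_integral (\<lambda>u. u) (\<lambda>u. exponent (H' \<omega> u)) =
        (\<Sum>v\<in>J. ennreal (c v) * emeasure lborel (clock (\<lambda>u. u) -` I v \<omega>))"
      using I_sets c by (simp add: clock_integral_sum_of_bool[OF regular_path_id])
    \<comment> \<open>The identity clock is \<open>max 0\<close>, which leaves preimages of sets of
      positive reals unchanged.\<close>
    moreover have "clock (\<lambda>u. u) -` level v (Z \<omega>) = level v (Z \<omega>)" "clock (\<lambda>u. u) -` I v \<omega> = I v \<omega>" for v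
      by (auto simp: clock_id level_def I_def max_def split: if_splits)
    ultimately show ?case
      by (simp add: I_def emeasure_lborel_initial occ_def)
  qed
  have int_SH: "(\<lambda>\<omega>. clock_integral (S_path \<omega>) (H \<omega>)) \<in> borel_measurable (completion M)"
    "(\<lambda>\<omega>. clock_integral (S_path \<omega>) (H' \<omega>)) \<in> borel_measurable (completion M)"
    "(\<lambda>\<omega>. clock_integral (\<lambda>u. u) (\<lambda>u. exponent (H \<omega> u))) \<in> borel_measurable (completion M)"
    "(\<lambda>\<omega>. clock_integral (\<lambda>u. u) (\<lambda>u. exponent (H' \<omega> u))) \<in> borel_measurable (completion M)"
    using H H' by (auto simp: exponential_formula_def)
  show meas: "(\<lambda>\<omega>. \<Sum>v\<in>J. of_nat (k v) * Y v \<omega>) \<in> borel_measurable (completion M)"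
    by (rule borel_measurable_completion_AE[OF int_SH(1) SH]) simp
  show meas': "(\<lambda>\<omega>. \<Sum>v\<in>J. of_nat (k v) * Y' v \<omega>) \<in> borel_measurable (completion M)"
    by (rule borel_measurable_completion_AE[OF int_SH(2) SH']) simp
  have cong: "(\<integral>\<omega>. exp_neg (f \<omega>) \<partial>completion M) = (\<integral>\<omega>. exp_neg (g \<omega>) \<partial>completion M)"
    if [measurable]: "f \<in> borel_measurable (completion M)" "g \<in> borel_measurable (completion M)"
      and "AE \<omega> in M. f \<omega> = g \<omega>" for f g
  proof (rule integral_cong_AE)
    show "AE \<omega> in completion M. exp_neg (f \<omega>) = exp_neg (g \<omega>)"
      using AE_completion[OF that(3)] by eventually_elim simp
  qed measurable
  have "(\<integral>\<omega>. exp_neg (\<Sum>v\<in>J. of_nat (k v) * Y v \<omega>) \<partial>completion M) =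
      (\<integral>\<omega>. exp_neg (clock_integral (S_path \<omega>) (H \<omega>)) \<partial>completion M)"
    by (rule cong[OF int_SH(1) meas SH, symmetric])
  also have "\<dots> = (\<integral>\<omega>. exp_neg (clock_integral (\<lambda>u. u) (\<lambda>u. exponent (H \<omega> u))) \<partial>completion M)"
    using H by (simp add: exponential_formula_def)
  also have "\<dots> = (\<integral>\<omega>. exp_neg (clock_integral (\<lambda>u. u) (\<lambda>u. exponent (H' \<omega> u))) \<partial>completion M)"
    by (rule cong[OF int_SH(3,4) JH])
  also have "\<dots> = (\<integral>\<omega>. exp_neg (clock_integral (S_path \<omega>) (H' \<omega>)) \<partial>completion M)"
    using H' by (simp add: exponential_formula_def)
  also have "\<dots> = (\<integral>\<omega>. exp_neg (\<Sum>v\<in>J. of_nat (k v) * Y' v \<omega>) \<partial>completion M)"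
    by (rule cong[OF int_SH(2) meas' SH'])
  finally show "(\<integral>\<omega>. exp_neg (\<Sum>v\<in>J. of_nat (k v) * Y v \<omega>) \<partial>completion M) =
         (\<integral>\<omega>. exp_neg (\<Sum>v\<in>J. of_nat (k v) * Y' v \<omega>) \<partial>completion M)" .
qed

theorem occupation_eq_in_law:
  "eq_in_law M
     (\<lambda>v \<omega>. occupation (time_changed X S) (upto_time (eval_ext S (\<tau> \<omega>) \<omega>)) {..v} \<omega>)
     (\<lambda>v \<omega>. eval_ext S (occupation X (upto_time (\<tau> \<omega>)) {..v} \<omega>) \<omega>)"
proof -
  interpret C: prob_space "completion M"
    by (rule prob_spaceI) (simp add: emeasure_space_1)
  let ?Y = "\<lambda>v \<omega>. occupation (time_changed X S) (upto_time (eval_ext S (\<tau> \<omega>) \<omega>)) {..v} \<omega>"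
  let ?Y' = "\<lambda>v \<omega>. eval_ext S (occupation X (upto_time (\<tau> \<omega>)) {..v} \<omega>) \<omega>"
  have meas: "?Y v \<in> borel_measurable (completion M)" "?Y' v \<in> borel_measurable (completion M)" for v
    using exponential_formula_occupation(1,2)[of "{v}" "\<lambda>_. 1"] by simp_all
  have "distr (completion M) (PiM UNIV (\<lambda>_. borel)) (\<lambda>\<omega> v. ?Y v \<omega>) =
      distr (completion M) (PiM UNIV (\<lambda>_. borel)) (\<lambda>\<omega> v. ?Y' v \<omega>)"
    by (intro C.Laplace_imp_distr_PiM_eq meas exponential_formula_occupation(3))
  then show ?thesis
    unfolding eq_in_law_def using meas by (auto intro!: measurable_PiM_single')
qed

end

theorem theorem3:
  fixes M :: "'w measure"
    and X S :: "real \<Rightarrow> 'w \<Rightarrow> real"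
    and \<tau> \<tau>_star :: "'w \<Rightarrow> ennreal"
    and A A_star :: "real \<Rightarrow> 'w \<Rightarrow> ennreal"
  assumes "prob_space M"
    and "cadlag_process M X"
    and "subordinator M S"
    and "AE \<omega> in M. strict_mono_on {0..} (\<lambda>t. S t \<omega>)"
    and "\<tau> \<in> borel_measurable M"
    and "indep_elements M path_space (path_on S)
           (path_space \<Otimes>\<^sub>M borel) (\<lambda>\<omega>. (path_on X \<omega>, \<tau> \<omega>))"
    and "\<And>\<omega>. \<tau>_star \<omega> = eval_ext S (\<tau> \<omega>) \<omega>"
    and "\<And>v \<omega>. A v \<omega> = occupation X (upto_time (\<tau> \<omega>)) {..v} \<omega>"
    and "\<And>v \<omega>. A_star v \<omega> = occupation (time_changed X S) (upto_time (\<tau>_star \<omega>)) {..v} \<omega>"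
  shows "eq_in_law M A_star (\<lambda>v \<omega>. eval_ext S (A v \<omega>) \<omega>)"
proof -
  interpret prob_space M by fact
  interpret independent_time_change M S X \<tau>
    using assms by unfold_locales
  have "A_star = (\<lambda>v \<omega>. occupation (time_changed X S) (upto_time (eval_ext S (\<tau> \<omega>) \<omega>)) {..v} \<omega>)"
    using assms(7,9) by (intro ext) simp
  moreover have "A = (\<lambda>v \<omega>. occupation X (upto_time (\<tau> \<omega>)) {..v} \<omega>)"
    using assms(8) by (intro ext)
  ultimately show ?thesis
    using occupation_eq_in_law by simp
qed

end
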